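(* For every fixed integer $\delta\ge1$ there is a polynomial $N_\delta(d;y)\in\mathbb Q[y,y^{-1},d]$, of degree $2\delta$ in $d$ and of degree $\delta$ in $y$ and in $y^{-1}$, such that $$N_\delta(d;y)=N^{d,\delta}(y)$$ for all integers $d\ge\delta$, where $N^{d,\delta}(y)$ is the refined Severi degree of $\mathbb P^2$.
   Context: **Refined Severi degrees of $\mathbb P^2$.** For an integer $n$, $[n]_y=\frac{y^{n/2}-y^{-n/2}}{y^{1/2}-y^{-1/2}}$. A sequence is $\alpha=(\alpha_1,\alpha_2,\dots)$ with entries in $\mathbb Z_{\ge0}$, almost all zero; $|\alpha|=\sum\alpha_i$, $I\alpha=\sum i\alpha_i$, $\binom{\alpha}{\beta}=\prod_i\binom{\alpha_i}{\beta_i}$; sums and $\le$ are entrywise; $e_k$ is the $k$-th unit sequence; trailing zeros are omitted. For $d\ge1$, $\delta\in\mathbb Z$ and sequences $\alpha,\beta$ with $I\alpha+I\beta=d$, put $\gamma=\frac{d(d+3)}2-d+|\beta|-\delta$. The refined relative Severi degree $N^{d,\delta}(\alpha,\beta)(y)\in\mathbb Z[y^{\pm1/2}]$ is defined recursively: $N^{1,0}((1),(0))(y)=1$; all values with $\delta<0$ or $\gamma\le0$ (or $d\le0$) are $0$; in all other cases $$N^{d,\delta}(\alpha,\beta)(y)=\sum_{k:\beta_k>0}[k]_y\,N^{d,\delta}(\alpha+e_k,\beta-e_k)(y)+\sum_{\alpha',\beta',\delta'}\Big(\prod_i[i]_y^{\beta'_i-\beta_i}\Big)\binom{\alpha}{\alpha'}\binom{\beta'}{\beta}N^{d-1,\delta'}(\alpha',\beta')(y),$$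 the second sum over $\alpha'\le\alpha$, $\beta'\ge\beta$ with $I\alpha'+I\beta'=d-1$ and $\delta'=\delta-(d-1)+|\beta'-\beta|$. The refined Severi degree is $N^{d,\delta}(y)=N^{d,\delta}((0),(d))(y)$, where $(d)$ is the sequence with first entry $d$; it is a Laurent polynomial in $y$. *)

theory Defs
  imports "HOL-Library.Poly_Mapping" "HOL-Computational_Algebra.Polynomial"
begin

text \<open>
  The ring \<open>R[z, 1/z]\<close> of Laurent polynomials is \<open>int \<Rightarrow>\<^sub>0 R\<close> with the convolution product of
  \<^theory>\<open>HOL-Library.Poly_Mapping\<close>; \<open>Poly_Mapping.single n c\<close> is the monomial \<open>c z^n\<close>.
  The refined Severi degrees are Laurent polynomials in \<open>y^(1/2)\<close>: in \<open>half_laurent\<close> the variable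
  is \<open>z = y^(1/2)\<close>, in \<open>laurent\<close> it is \<open>z = y\<close>.
\<close>

type_synonym 'a laurent = "int \<Rightarrow>\<^sub>0 'a"
type_synonym 'a half_laurent = "int \<Rightarrow>\<^sub>0 'a"

abbreviation y_half_pow :: "int \<Rightarrow> int half_laurent" where
  "y_half_pow n \<equiv> Poly_Mapping.single n 1"

text \<open>The inclusion of \<open>R[y, 1/y]\<close> in \<open>R[y^(1/2), y^(-1/2)]\<close>.\<close>

definition laurent_to_half :: "'a::comm_monoid_add laurent \<Rightarrow> 'a half_laurent" where
  "laurent_to_half p =
     (\<Sum>n\<in>Poly_Mapping.keys p. Poly_Mapping.single (2 * n) (Poly_Mapping.lookup p n))"

definition quantum_int :: "int \<Rightarrow> int half_laurent" where
  "quantum_int n =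
     (THE q. q * (y_half_pow 1 - y_half_pow (-1)) = y_half_pow n - y_half_pow (-n))"

text \<open>The quotient defining \<open>quantum_int n\<close> exists in \<open>\<int>[y^(1/2), y^(-1/2)]\<close> and is unique.\<close>

lemma quantum_int_ex1:
  "\<exists>!q. q * (y_half_pow 1 - y_half_pow (-1)) = y_half_pow n - y_half_pow (-n)"
proof -
  have nonzero: "y_half_pow 1 - y_half_pow (-1) \<noteq> 0"
  proof
    assume "y_half_pow 1 - y_half_pow (-1) = 0"
    then have "Poly_Mapping.lookup (y_half_pow 1) 1 = Poly_Mapping.lookup (y_half_pow (-1)) 1"
      by simp
    then show False by (simp add: lookup_single)
  qed
  have pos: "\<exists>q. q * (y_half_pow 1 - y_half_pow (-1)) = y_half_pow (int m) - y_half_pow (- int m)"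
    for m
  proof (induction m)
    case 0
    show ?case by (intro exI[of _ 0]) simp
  next
    case (Suc m)
    then obtain q
      where q: "q * (y_half_pow 1 - y_half_pow (-1)) = y_half_pow (int m) - y_half_pow (- int m)"
      by blast
    have "(y_half_pow 1 * q + y_half_pow (- int m)) * (y_half_pow 1 - y_half_pow (-1)) =
        y_half_pow 1 * (y_half_pow (int m) - y_half_pow (- int m))
          + y_half_pow (- int m) * (y_half_pow 1 - y_half_pow (-1))"
      by (simp only: q[symmetric] distrib_right mult.assoc)
    also have "\<dots> = y_half_pow (int (Suc m)) - y_half_pow (- int (Suc m))"
      by (simp add: right_diff_distrib mult_single algebra_simps)
    finally show ?case by blast
  qed
  have "\<exists>q. q * (y_half_pow 1 - y_half_pow (-1)) = y_half_pow n - y_half_pow (-n)"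
  proof (cases "n \<ge> 0")
    case True
    then show ?thesis using pos[of "nat n"] by simp
  next
    case False
    then obtain q where "q * (y_half_pow 1 - y_half_pow (-1)) = y_half_pow (-n) - y_half_pow n"
      using pos[of "nat (-n)"] by auto
    then have "(- q) * (y_half_pow 1 - y_half_pow (-1)) = y_half_pow n - y_half_pow (-n)"
      by simp
    then show ?thesis by blast
  qed
  then show ?thesis
    using nonzero by (metis mult_right_cancel)
qed

text \<open>
  A sequence \<open>\<alpha> = (\<alpha>_1, \<alpha>_2, \<dots>)\<close> is a finitely supported map with \<open>lookup \<alpha> i = \<alpha>_i\<close> for \<open>i \<ge> 1\<close>
  and \<open>lookup \<alpha> 0 = 0\<close>; thus \<open>e_k\<close> is \<open>single k 1\<close>. The order of \<open>\<Rightarrow>\<^sub>0\<close> in the library is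
  lexicographic, hence the separate entrywise relation.
\<close>

type_synonym sequence = "nat \<Rightarrow>\<^sub>0 nat"

definition seq_le :: "sequence \<Rightarrow> sequence \<Rightarrow> bool" where
  "seq_le \<alpha> \<beta> \<longleftrightarrow> (\<forall>i. Poly_Mapping.lookup \<alpha> i \<le> Poly_Mapping.lookup \<beta> i)"

definition seq_size :: "sequence \<Rightarrow> nat" where
  "seq_size \<alpha> = (\<Sum>i\<in>Poly_Mapping.keys \<alpha>. Poly_Mapping.lookup \<alpha> i)"

definition seq_weight :: "sequence \<Rightarrow> nat" where
  "seq_weight \<alpha> = (\<Sum>i\<in>Poly_Mapping.keys \<alpha>. i * Poly_Mapping.lookup \<alpha> i)"

definition seq_binomial :: "sequence \<Rightarrow> sequence \<Rightarrow> nat" where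
  "seq_binomial \<alpha> \<beta> = (\<Prod>i\<in>Poly_Mapping.keys \<alpha> \<union> Poly_Mapping.keys \<beta>.
     Poly_Mapping.lookup \<alpha> i choose Poly_Mapping.lookup \<beta> i)"

lemma seq_size_remove_less:
  assumes "k \<in> Poly_Mapping.keys \<beta>"
  shows "seq_size (\<beta> - Poly_Mapping.single k 1) < seq_size \<beta>"
proof -
  let ?\<beta>' = "\<beta> - Poly_Mapping.single k (1::nat)"
  have le: "Poly_Mapping.lookup ?\<beta>' i \<le> Poly_Mapping.lookup \<beta> i" for i
    by (simp add: lookup_minus)
  have sub: "Poly_Mapping.keys ?\<beta>' \<subseteq> Poly_Mapping.keys \<beta>"
    using le by (metis in_keys_iff le_zero_eq subsetI)
  have "seq_size ?\<beta>' = (\<Sum>i\<in>Poly_Mapping.keys \<beta>. Poly_Mapping.lookup ?\<beta>' i)"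
    unfolding seq_size_def by (rule sum.mono_neutral_left) (use sub in \<open>auto simp: in_keys_iff\<close>)
  also have "\<dots> < (\<Sum>i\<in>Poly_Mapping.keys \<beta>. Poly_Mapping.lookup \<beta> i)"
    by (rule sum_strict_mono_ex1)
      (use assms le in \<open>auto simp: lookup_minus in_keys_iff intro!: bexI[of _ k]\<close>)
  finally show ?thesis by (simp add: seq_size_def)
qed

text \<open>
  \<open>refined_rel_severi d \<delta> \<alpha> \<beta>\<close> is meaningful for sequences with
  \<open>seq_weight \<alpha> + seq_weight \<beta> = d\<close>, a condition which the recursion preserves. The index set of
  the second sum is finite, because the entries of \<open>\<beta>'\<close> at index \<open>0\<close> are excluded.
\<close>

function refined_rel_severi ::
  "nat \<Rightarrow> int \<Rightarrow> sequence \<Rightarrow> sequence \<Rightarrow> int half_laurent" where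
  "refined_rel_severi d \<delta> \<alpha> \<beta> =
    (if d = 0 \<or> \<delta> < 0 \<or> int (d * (d + 3) div 2) - int d + int (seq_size \<beta>) - \<delta> \<le> 0 then 0
     else if d = 1 \<and> \<delta> = 0 \<and> \<alpha> = Poly_Mapping.single 1 1 \<and> \<beta> = 0 then 1
     else
       (\<Sum>k\<in>Poly_Mapping.keys \<beta>. quantum_int (int k) *
          refined_rel_severi d \<delta> (\<alpha> + Poly_Mapping.single k 1) (\<beta> - Poly_Mapping.single k 1))
     + (\<Sum>(\<alpha>', \<beta>')\<in>{(\<alpha>', \<beta>'). seq_le \<alpha>' \<alpha> \<and> seq_le \<beta> \<beta>' \<and> Poly_Mapping.lookup \<beta>' 0 = 0 \<and>
                                seq_weight \<alpha>' + seq_weight \<beta>' = d - 1}.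
          (\<Prod>i\<in>Poly_Mapping.keys \<beta>'.
             quantum_int (int i) ^ (Poly_Mapping.lookup \<beta>' i - Poly_Mapping.lookup \<beta> i)) *
          of_nat (seq_binomial \<alpha> \<alpha>') * of_nat (seq_binomial \<beta>' \<beta>) *
          refined_rel_severi (d - 1) (\<delta> - (int d - 1) + int (seq_size (\<beta>' - \<beta>))) \<alpha>' \<beta>'))"
  by pat_completeness auto
termination
  by (relation "measures [\<lambda>(d, \<delta>, \<alpha>, \<beta>). d, \<lambda>(d, \<delta>, \<alpha>, \<beta>). seq_size \<beta>]")
    (auto intro: seq_size_remove_less[unfolded One_nat_def])

declare refined_rel_severi.simps [simp del]

definition refined_severi :: "nat \<Rightarrow> int \<Rightarrow> int half_laurent" where
  "refined_severi d \<delta> = refined_rel_severi d \<delta> 0 (Poly_Mapping.single 1 d)"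

text \<open>
  Elements of \<open>\<rat>[y, 1/y, d]\<close> are polynomials in \<open>d\<close> over \<open>\<rat>[y, 1/y]\<close>. The set
  \<open>y_exponents P\<close> is finite, and it is nonempty exactly for \<open>P \<noteq> 0\<close>.
\<close>

definition y_exponents :: "'a::zero laurent poly \<Rightarrow> int set" where
  "y_exponents P = (\<Union>i. Poly_Mapping.keys (coeff P i))"

definition degree_y :: "'a::zero laurent poly \<Rightarrow> int" where
  "degree_y P = Max (y_exponents P)"

definition degree_y_inverse :: "'a::zero laurent poly \<Rightarrow> int" where
  "degree_y_inverse P = Max (uminus ` y_exponents P)"

end

theory Submission
  imports Defs "HOL-Library.FuncSet"
begin

text \<open>
  The recursion moves edges from \<open>\<beta>\<close> to \<open>\<alpha>\<close> (marking) and lowers the degree (floors). Passing a floor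
  from degree \<open>j\<close> to \<open>j - 1\<close> decreases \<open>\<delta>\<close> by the weight of all edges that survive the floor plus
  weight minus one for each new edge. So at cost \<open>0\<close> every edge is consumed and all new edges have
  weight one, and the state after a floor is a bounded deviation \<open>(\<alpha>, \<nu>)\<close> from the normal state
  \<open>\<alpha> = 0\<close>, \<open>\<beta> = m e_1\<close>, where \<open>\<beta> = \<nu> + m e_1\<close> and \<open>m = j - I \<alpha> - I \<nu>\<close>. Merging all markings
  between two floors gives a finite transfer recursion whose coefficients are products of binomial
  coefficients polynomial in \<open>j\<close>, and whose only cost-free transition leads to the normal state.
  For the normal state this is a difference equation, so induction on \<open>\<delta>\<close> gives polynomials in \<open>j\<close>.

  The threshold is the point of the argument: the value at \<open>(\<alpha>, \<nu>)\<close> agrees with its polynomial for all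
  \<open>j \<ge> \<delta> + I \<alpha> + I \<nu> - \<bar>\<nu>\<bar>\<close>, where \<open>m\<close> may be as small as \<open>- \<bar>\<nu>\<bar>\<close>; for negative \<open>m\<close> the value is
  \<open>0\<close> by convention and every term of the recursion vanishes because of the multinomial coefficient
  that counts the orders of marking. The top coefficients satisfy
  \<open>2 \<delta> L_\<delta> = (2 + [2]\<^sup>2) L_(\<delta> - 1) = (y + 4 + 1/y) L_(\<delta> - 1)\<close>, the three terms
  coming from the transitions of cost one, and the exponents of \<open>y\<close> are bounded directly from the recursion.
\<close>

section \<open>Laurent polynomials and quantum integers\<close>

abbreviation "lookup \<equiv> Poly_Mapping.lookup"
abbreviation "single \<equiv> Poly_Mapping.single"
abbreviation "keys \<equiv> Poly_Mapping.keys"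

text \<open>The parity condition makes all exponents of y^(1/2) congruent to \<open>w\<close>. For
  even \<open>w\<close> only integral powers of y occur, which lets the final polynomial descend to
  \<open>laurent\<close>.\<close>

definition exps_within :: "int \<Rightarrow> 'a::comm_ring_1 half_laurent \<Rightarrow> bool" where
  "exps_within w p \<longleftrightarrow> (\<forall>n. lookup p n \<noteq> 0 \<longrightarrow> \<bar>n\<bar> \<le> w \<and> even (n + w))"

lemma exps_within_0 [simp]: "exps_within w 0"
  by (simp add: exps_within_def)

lemma exps_within_add: "exps_within w p \<Longrightarrow> exps_within w q \<Longrightarrow> exps_within w (p + q)"
  unfolding exps_within_def lookup_add by (metis add.left_neutral)

lemma exps_within_sum: "(\<And>i. i \<in> I \<Longrightarrow> exps_within w (f i)) \<Longrightarrow> exps_within w (sum f I)"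
  by (induction I rule: infinite_finite_induct) (auto intro: exps_within_add)

lemma exps_within_single: "\<bar>n\<bar> \<le> w \<Longrightarrow> even (n + w) \<Longrightarrow> exps_within w (single n c)"
  by (auto simp: exps_within_def lookup_single when_def)

lemma exps_within_1: "exps_within 0 1"
  by (metis abs_zero add.right_neutral dvd_0_right exps_within_single order_refl single_one)

lemma exps_within_mult:
  assumes "exps_within v p" "exps_within w q"
  shows "exps_within (v + w) (p * q)"
  unfolding exps_within_def
proof (intro allI impI)
  fix n assume "lookup (p * q) n \<noteq> 0"
  then have "n \<in> keys (p * q)" by (simp add: in_keys_iff)
  then obtain a b where "n = a + b" "a \<in> keys p" "b \<in> keys q" using keys_mult by blast
  then have "\<bar>a\<bar> \<le> v \<and> even (a + v)" "\<bar>b\<bar> \<le> w \<and> even (b + w)" "n = a + b"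
    using assms by (auto simp: exps_within_def in_keys_iff)
  moreover have "n + (v + w) = (a + v) + (b + w)" using \<open>n = a + b\<close> by simp
  ultimately show "\<bar>n\<bar> \<le> v + w \<and> even (n + (v + w))" by auto
qed

lemma exps_within_mono: "exps_within v p \<Longrightarrow> v \<le> w \<Longrightarrow> even (w - v) \<Longrightarrow> exps_within w p"
  unfolding exps_within_def
  by (smt (verit) even_add even_diff)

lemma exps_within_of_nat: "exps_within 0 (of_nat n)"
  by (induction n) (auto intro: exps_within_add exps_within_1)

lemma exps_within_power: "exps_within w p \<Longrightarrow> exps_within (int n * w) (p ^ n)"
proof (induction n)
  case (Suc n)
  then show ?case using exps_within_mult[of w p "int n * w" "p ^ n"] by (simp add: algebra_simps)
qed (simp add: exps_within_1)

lemma exps_within_prod: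
  "(\<And>i. i \<in> I \<Longrightarrow> exps_within (w i) (f i)) \<Longrightarrow> exps_within (sum w I) (prod f I)"
  by (induction I rule: infinite_finite_induct) (auto intro: exps_within_1 exps_within_mult)

lemma quantum_int_eqI:
  "q * (y_half_pow 1 - y_half_pow (-1)) = y_half_pow n - y_half_pow (-n) \<Longrightarrow> quantum_int n = q"
  unfolding quantum_int_def using quantum_int_ex1[of n] by (blast intro: the1_equality)

lemma quantum_int_spec:
  "quantum_int n * (y_half_pow 1 - y_half_pow (-1)) = y_half_pow n - y_half_pow (-n)"
  unfolding quantum_int_def using quantum_int_ex1[of n] by (rule theI')

lemma quantum_int_1: "quantum_int 1 = 1"
  by (rule quantum_int_eqI) simp

lemma quantum_int_Suc:
  "quantum_int (int (Suc m)) = y_half_pow 1 * quantum_int (int m) + y_half_pow (- int m)"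
proof (rule quantum_int_eqI)
  have "(y_half_pow 1 * quantum_int (int m) + y_half_pow (- int m)) * (y_half_pow 1 - y_half_pow (-1)) =
        y_half_pow 1 * (y_half_pow (int m) - y_half_pow (- int m))
          + y_half_pow (- int m) * (y_half_pow 1 - y_half_pow (-1))"
    by (simp only: quantum_int_spec[of "int m", symmetric] distrib_right mult.assoc)
  also have "\<dots> = y_half_pow (int (Suc m)) - y_half_pow (- int (Suc m))"
    by (simp add: right_diff_distrib mult_single algebra_simps)
  finally show "(y_half_pow 1 * quantum_int (int m) + y_half_pow (- int m)) * (y_half_pow 1 - y_half_pow (-1))
    = y_half_pow (int (Suc m)) - y_half_pow (- int (Suc m))" .
qed

lemma quantum_int_2: "quantum_int 2 = single 1 1 + single (-1) 1"
  using quantum_int_Suc[of 1] quantum_int_1 by simp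

lemma exps_within_quantum_int: "exps_within (int m) (quantum_int (int (Suc m)))"
proof (induction m)
  case 0 show ?case using exps_within_1 quantum_int_1 by simp
next
  case (Suc m)
  have "exps_within (1 + int m) (y_half_pow 1 * quantum_int (int (Suc m)))"
    by (rule exps_within_mult[OF exps_within_single Suc.IH]) auto
  moreover have "exps_within (1 + int m) (y_half_pow (- int (Suc m)))"
    by (rule exps_within_single) auto
  ultimately show ?case
    by (subst quantum_int_Suc) (auto intro: exps_within_add simp: add.commute)
qed

section \<open>Extension of scalars from the integers to the rationals\<close>

abbreviation rat_laurent :: "int half_laurent \<Rightarrow> rat half_laurent" where
  "rat_laurent \<equiv> Poly_Mapping.map rat_of_int"

lemma lookup_rat_laurent [simp]: "lookup (rat_laurent p) n = of_int (lookup p n)"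
  by transfer (auto simp: when_def)

lemma rat_laurent_0 [simp]: "rat_laurent 0 = 0"
  by (rule poly_mapping_eqI) simp

lemma rat_laurent_add: "rat_laurent (p + q) = rat_laurent p + rat_laurent q"
  by (rule poly_mapping_eqI) (simp add: lookup_add)

lemma rat_laurent_sum: "rat_laurent (sum f I) = (\<Sum>i\<in>I. rat_laurent (f i))"
  by (induction I rule: infinite_finite_induct) (auto simp: rat_laurent_add)

lemma rat_laurent_1 [simp]: "rat_laurent 1 = 1"
  by (rule poly_mapping_eqI) (simp add: lookup_one when_def)

lemma poly_mapping_sum_single: "p = (\<Sum>n\<in>keys p. single n (lookup p n))"
  by (rule poly_mapping_eqI) (auto simp: lookup_sum lookup_single when_def in_keys_iff)

text \<open>Both sides are biadditive, so it suffices to compare products of monomials.\<close>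

lemma rat_laurent_mult: "rat_laurent (p * q) = rat_laurent p * rat_laurent q"
proof -
  have s: "rat_laurent (single m a) = single m (of_int a)" for m a
    by (rule poly_mapping_eqI) (simp add: lookup_single when_def)
  have "rat_laurent (p * q) = rat_laurent
      ((\<Sum>n\<in>keys p. single n (lookup p n)) * (\<Sum>n\<in>keys q. single n (lookup q n)))"
    using poly_mapping_sum_single by metis
  also have "\<dots> = rat_laurent (\<Sum>n\<in>keys p. single n (lookup p n))
      * rat_laurent (\<Sum>n\<in>keys q. single n (lookup q n))"
    by (simp add: sum_product rat_laurent_sum s mult_single)
  also have "\<dots> = rat_laurent p * rat_laurent q"
    using poly_mapping_sum_single by metis
  finally show ?thesis .
qed

lemma rat_laurent_power: "rat_laurent (p ^ n) = rat_laurent p ^ n"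
  by (induction n) (auto simp: rat_laurent_mult)

lemma rat_laurent_prod: "rat_laurent (prod f I) = (\<Prod>i\<in>I. rat_laurent (f i))"
  by (induction I rule: infinite_finite_induct) (auto simp: rat_laurent_mult)

lemma rat_laurent_of_nat: "rat_laurent (of_nat n) = of_nat n"
  by (induction n) (auto simp: rat_laurent_add)

lemma exps_within_rat_laurent: "exps_within w p \<Longrightarrow> exps_within w (rat_laurent p)"
  by (simp add: exps_within_def)

abbreviation const :: "rat \<Rightarrow> rat half_laurent" where
  "const \<equiv> single 0"

lemma const_mult: "const (a * b) = const a * const b"
  by (simp add: mult_single)

lemma const_of_nat: "const (of_nat n) = of_nat n" by simp

lemma const_sum: "const (sum f I) = (\<Sum>i\<in>I. const (f i))"
  by (induction I rule: infinite_finite_induct) (auto simp: single_add)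

lemma lookup_mult_single: 
  "lookup (p * single k c) n = lookup p (n - k) * c" for p :: "'a::comm_ring_1 half_laurent"
proof -
  have "lookup (p * single k c) n = lookup ((\<Sum>m\<in>keys p. single m (lookup p m)) * single k c) n"
    using poly_mapping_sum_single by metis
  also have "\<dots> = (\<Sum>m\<in>keys p. if m = n - k then lookup p m * c else 0)"
    by (simp add: sum_distrib_right lookup_sum mult_single lookup_single when_def
        eq_diff_eq cong: sum.cong)
  also have "\<dots> = lookup p (n - k) * c"
    by (simp add: in_keys_iff)
  finally show ?thesis .
qed

lemma lookup_mult_of_nat: "lookup (p * of_nat k) n = lookup p n * of_nat k"
  for p :: "'a::comm_ring_1 half_laurent"
  by (metis diff_zero lookup_mult_single single_of_nat)

section \<open>Sequences\<close>

lemma seq_size_superset: "finite A \<Longrightarrow> keys p \<subseteq> A \<Longrightarrow> seq_size p = (\<Sum>i\<in>A. lookup p i)"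
  unfolding seq_size_def by (rule sum.mono_neutral_left) (auto simp: in_keys_iff)

lemma seq_weight_superset: "finite A \<Longrightarrow> keys p \<subseteq> A \<Longrightarrow> seq_weight p = (\<Sum>i\<in>A. i * lookup p i)"
  unfolding seq_weight_def by (rule sum.mono_neutral_left) (auto simp: in_keys_iff)

lemma keys_add_nat: "keys (p + q) = keys p \<union> keys q" for p q :: sequence
  by (auto simp: in_keys_iff lookup_add)

lemma seq_size_add: "seq_size (p + q) = seq_size p + seq_size q"
  using seq_size_superset[of "keys p \<union> keys q"]
  by (simp add: keys_add_nat lookup_add sum.distrib)

lemma seq_weight_add: "seq_weight (p + q) = seq_weight p + seq_weight q"
  using seq_weight_superset[of "keys p \<union> keys q"]
  by (simp add: keys_add_nat lookup_add sum.distrib distrib_left)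

lemma seq_size_single [simp]: "seq_size (single k n) = n"
  by (cases "n = 0") (simp_all add: seq_size_def)

lemma seq_weight_single [simp]: "seq_weight (single k n) = k * n"
  by (cases "n = 0") (simp_all add: seq_weight_def)

lemma seq_size_0 [simp]: "seq_size 0 = 0" and seq_weight_0 [simp]: "seq_weight 0 = 0"
  by (simp_all add: seq_size_def seq_weight_def)

lemma seq_size_eq_0_iff [simp]: "seq_size p = 0 \<longleftrightarrow> p = 0"
  by (auto simp: seq_size_def in_keys_iff intro: poly_mapping_eqI)

lemma seq_le_add_diff: "seq_le p q \<Longrightarrow> p + (q - p) = q"
  by (rule poly_mapping_eqI) (simp add: seq_le_def lookup_add lookup_minus)

lemma seq_le_diff: "seq_le (q - p) q"
  by (simp add: seq_le_def lookup_minus)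

lemma seq_le_refl [simp]: "seq_le p p" and seq_le_0 [simp]: "seq_le 0 p"
  by (simp_all add: seq_le_def)

lemma seq_le_single: "k \<in> keys p \<Longrightarrow> seq_le (single k 1) p"
  by (auto simp: seq_le_def lookup_single when_def in_keys_iff)

lemma seq_size_diff: "seq_le p q \<Longrightarrow> seq_size (q - p) = seq_size q - seq_size p"
  by (metis seq_le_add_diff seq_size_add add_diff_cancel_left')

lemma seq_weight_diff: "seq_le p q \<Longrightarrow> seq_weight (q - p) = seq_weight q - seq_weight p"
  by (metis seq_le_add_diff seq_weight_add add_diff_cancel_left')

lemma seq_size_mono: "seq_le p q \<Longrightarrow> seq_size p \<le> seq_size q"
  by (metis le_add1 seq_le_add_diff seq_size_add)

lemma seq_weight_mono: "seq_le p q \<Longrightarrow> seq_weight p \<le> seq_weight q"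
  by (metis le_add1 seq_le_add_diff seq_weight_add)

lemma seq_size_le_weight: "lookup p 0 = 0 \<Longrightarrow> seq_size p \<le> seq_weight p"
  unfolding seq_size_def seq_weight_def
  by (rule sum_mono) (metis gr0I in_keys_iff le_add1 mult_eq_if not_gr_zero)

text \<open>A sequence below \<open>q\<close> vanishes off the support of \<open>q\<close>, so its
  restriction to that finite set determines it.\<close>

lemma finite_seq_le: "finite {s. seq_le s q}"
proof -
  have "(\<lambda>s. restrict (lookup s) (keys q)) ` {s. seq_le s q} \<subseteq> (PiE (keys q) (\<lambda>i. {..lookup q i}))"
    by (auto simp: seq_le_def)
  then have "finite ((\<lambda>s. restrict (lookup s) (keys q)) ` {s. seq_le s q})"
    using finite_PiE finite_subset finite_keys finite_atMost by metis
  moreover have "inj_on (\<lambda>s. restrict (lookup s) (keys q)) {s. seq_le s q}"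
  proof (rule inj_onI, rule poly_mapping_eqI)
    fix s t i assume *: "s \<in> {s. seq_le s q}" "t \<in> {s. seq_le s q}"
      "restrict (lookup s) (keys q) = restrict (lookup t) (keys q)"
    show "lookup s i = lookup t i"
    proof (cases "i \<in> keys q")
      case True
      then show ?thesis using fun_cong[OF *(3), of i] by simp
    next
      case False
      then have "lookup q i = 0" by (simp add: in_keys_iff)
      then show ?thesis using *(1,2) by (metis le_zero_eq mem_Collect_eq seq_le_def)
    qed
  qed
  ultimately show ?thesis by (rule finite_imageD)
qed

lemma lookup_le_seq_weight: "i > 0 \<Longrightarrow> lookup p i \<le> seq_weight p"
proof (cases "i \<in> keys p")
  case True
  assume "i > 0"
  then have "lookup p i \<le> i * lookup p i" by simp
  also have "\<dots> \<le> seq_weight p" unfolding seq_weight_def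
    by (rule member_le_sum) (use True in auto)
  finally show ?thesis .
qed (simp add: in_keys_iff)

lemma index_le_seq_weight: assumes "lookup p i \<noteq> 0" shows "i \<le> seq_weight p"
proof -
  have "i \<le> i * lookup p i" using assms by simp
  also have "\<dots> \<le> seq_weight p" unfolding seq_weight_def
    by (rule member_le_sum) (use assms in \<open>auto simp: in_keys_iff\<close>)
  finally show ?thesis .
qed

lemma finite_seq_weight_le: "finite {p. lookup p 0 = 0 \<and> seq_weight p \<le> n}"
proof (rule finite_subset)
  \<comment> \<open>Bounded weight bounds both the support and the entries at positive indices, so a
    sequence constant on \<open>{..n}\<close> dominates all candidates.\<close>
  let ?q = "(\<Sum>i\<le>n. single i n) :: sequence"
  show "{p. lookup p 0 = 0 \<and> seq_weight p \<le> n} \<subseteq> {s. seq_le s ?q}"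
  proof safe
    fix p assume p: "lookup p 0 = 0" "seq_weight p \<le> n"
    have "lookup p i \<le> (if i \<le> n then n else 0)" for i
      using lookup_le_seq_weight[of i p] index_le_seq_weight[of p i] p
      by (cases "i = 0"; cases "lookup p i = 0"; auto)
    moreover have "lookup ?q i = (if i \<le> n then n else 0)" for i
      by (simp add: lookup_sum lookup_single when_def)
    ultimately show "seq_le p ?q" by (simp add: seq_le_def)
  qed
qed (rule finite_seq_le)

definition quantum_power :: "sequence \<Rightarrow> rat half_laurent" where
  "quantum_power s = (\<Prod>i\<in>keys s. rat_laurent (quantum_int (int i)) ^ lookup s i)"

definition seq_fact :: "sequence \<Rightarrow> rat" where
  "seq_fact s = (\<Prod>i\<in>keys s. fact (lookup s i))"

text \<open>The number of orders in which the edges of \<open>s\<close> can be marked, where edges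
  of equal weight are indistinguishable.\<close>

definition multinomial :: "sequence \<Rightarrow> rat" where
  "multinomial s = fact (seq_size s) / seq_fact s"

text \<open>In the states of the recursion only the number of edges of weight one grows with the
  degree; it is split off here.\<close>

definition drop1 :: "sequence \<Rightarrow> sequence" where
  "drop1 p = p - single 1 (lookup p 1)"

lemma lookup_drop1: "lookup (drop1 p) i = (if i = 1 then 0 else lookup p i)"
  by (simp add: drop1_def lookup_minus lookup_single when_def)

lemma drop1_eq: "single 1 (lookup p 1) + drop1 p = p"
  by (rule poly_mapping_eqI) (simp add: lookup_add lookup_drop1 lookup_single when_def)

lemma drop1_add: "drop1 (p + q) = drop1 p + drop1 q"
  by (rule poly_mapping_eqI) (simp add: lookup_add lookup_drop1)

lemma drop1_single [simp]: "drop1 (single 1 n) = 0" "drop1 (single (Suc 0) n) = 0"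
  by (rule poly_mapping_eqI, simp add: lookup_drop1 lookup_single when_def)+

lemma drop1_ident: "lookup p 1 = 0 \<Longrightarrow> drop1 p = p"
  by (rule poly_mapping_eqI) (simp add: lookup_drop1)

lemma quantum_power_superset:
  "finite A \<Longrightarrow> keys s \<subseteq> A \<Longrightarrow> quantum_power s = (\<Prod>i\<in>A. rat_laurent (quantum_int (int i)) ^ lookup s i)"
  unfolding quantum_power_def by (rule prod.mono_neutral_left) (auto simp: in_keys_iff)

lemma quantum_power_0 [simp]: "quantum_power 0 = 1"
  by (simp add: quantum_power_def)

lemma quantum_power_single: "quantum_power (single k n) = rat_laurent (quantum_int (int k)) ^ n"
  by (cases "n = 0") (simp_all add: quantum_power_def)

lemma quantum_power_single1 [simp]: "quantum_power (single 1 n) = 1" "quantum_power (single (Suc 0) n) = 1"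
  using quantum_power_single[of 1 n] quantum_int_1 by simp_all

lemma quantum_power_add: "quantum_power (p + q) = quantum_power p * quantum_power q"
  using quantum_power_superset[of "keys p \<union> keys q"]
  by (simp add: keys_add_nat lookup_add power_add prod.distrib)

lemma seq_fact_superset:
  "finite A \<Longrightarrow> keys s \<subseteq> A \<Longrightarrow> seq_fact s = (\<Prod>i\<in>A. fact (lookup s i))"
  unfolding seq_fact_def by (rule prod.mono_neutral_left) (auto simp: in_keys_iff)

lemma seq_fact_pos: "seq_fact s > 0"
  by (simp add: seq_fact_def prod_pos)

lemma seq_fact_0 [simp]: "seq_fact 0 = 1" by (simp add: seq_fact_def)

lemma seq_fact_single_1_add:
  assumes "lookup s 1 = 0"
  shows "seq_fact (single 1 m + s) = fact m * seq_fact s"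
proof -
  let ?A = "insert 1 (keys s)"
  have 1: "1 \<notin> keys s" using assms by (simp add: in_keys_iff)
  have "seq_fact (single 1 m + s) = (\<Prod>i\<in>?A. fact (lookup (single 1 m + s) i))"
    by (rule seq_fact_superset) (auto simp: keys_add_nat split: if_splits)
  also have "\<dots> = fact m * (\<Prod>i\<in>keys s. fact (lookup s i))"
    using 1 assms by (subst prod.insert) (auto simp: lookup_add lookup_single when_def in_keys_iff intro!: prod.cong)
  finally show ?thesis by (simp add: seq_fact_def)
qed

lemma multinomial_0 [simp]: "multinomial 0 = 1"
  by (simp add: multinomial_def)

text \<open>An order is fixed by the positions of the edges of \<open>s\<close> among all
  \<open>m + seq_size s\<close> and their relative order. The dependence on \<open>m\<close> thus
  sits in one binomial coefficient.\<close>

lemma multinomial_single_1_add: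
  assumes "lookup s 1 = 0"
  shows "multinomial (single 1 m + s) = of_nat ((m + seq_size s) choose seq_size s) * multinomial s"
  using seq_fact_pos[of s]
  unfolding multinomial_def seq_fact_single_1_add[OF assms]
  by (simp add: seq_size_add binomial_fact field_simps)

text \<open>The orders are classified by the weight \<open>k\<close> of the edge marked
  first.\<close>

lemma multinomial_rec:
  assumes "s \<noteq> 0"
  shows "multinomial s = (\<Sum>k\<in>keys s. multinomial (s - single k 1))"
proof -
  have pos: "seq_size s \<noteq> 0" using assms by simp
  \<comment> \<open>A share \<open>lookup s k / seq_size s\<close> of the orders starts with weight
    \<open>k\<close>; these shares add up to one.\<close>
  have m: "multinomial (s - single k 1) = of_nat (lookup s k) / of_nat (seq_size s) * multinomial s"
    if k: "k \<in> keys s" for k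
  proof -
    let ?t = "s - single k (1::nat)"
    have s0: "lookup s k > 0" using k by (simp add: in_keys_iff)
    have sub: "keys ?t \<subseteq> keys s" by (auto simp: in_keys_iff lookup_minus)
    have "seq_fact s = fact (lookup s k) * (\<Prod>i\<in>keys s - {k}. fact (lookup s i))"
      unfolding seq_fact_def using k by (simp add: prod.remove)
    moreover have "seq_fact ?t = fact (lookup s k - 1) * (\<Prod>i\<in>keys s - {k}. fact (lookup s i))"
      unfolding seq_fact_superset[OF finite_keys sub] using k
      by (subst prod.remove[of _ k]) (auto simp: lookup_minus lookup_single when_def intro!: prod.cong)
    moreover have "fact (lookup s k) = (of_nat (lookup s k) * fact (lookup s k - 1) :: rat)"
      using s0 by (rule fact_reduce)
    ultimately have f: "seq_fact s = of_nat (lookup s k) * seq_fact ?t" by simp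
    have sz: "seq_size ?t = seq_size s - 1"
      using seq_size_diff[OF seq_le_single[OF k]] by simp
    have "seq_size s > 0" using pos by linarith
    then have "fact (seq_size s) = (of_nat (seq_size s) * fact (seq_size ?t) :: rat)"
      unfolding sz by (rule fact_reduce)
    then show ?thesis
      unfolding multinomial_def using f s0 seq_fact_pos[of ?t] pos by simp
  qed
  have "(\<Sum>k\<in>keys s. multinomial (s - single k 1))
      = (\<Sum>k\<in>keys s. of_nat (lookup s k)) / of_nat (seq_size s) * multinomial s"
    using m by (simp add: sum_divide_distrib sum_distrib_right)
  also have "(\<Sum>k\<in>keys s. of_nat (lookup s k)) = (of_nat (seq_size s) :: rat)"
    by (simp add: seq_size_def)
  finally show ?thesis using pos by simp
qed

lemma seq_binomial_superset:
  assumes "finite A" "keys p \<union> keys q \<subseteq> A"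
  shows "seq_binomial p q = (\<Prod>i\<in>A. lookup p i choose lookup q i)"
  unfolding seq_binomial_def by (rule prod.mono_neutral_left) (use assms in \<open>auto simp: in_keys_iff\<close>)

lemma seq_binomial_eq_0:
  assumes "\<not> seq_le q p" shows "seq_binomial p q = 0"
proof -
  obtain i where "lookup q i > lookup p i" using assms by (auto simp: seq_le_def not_le)
  then show ?thesis unfolding seq_binomial_def
    by (intro prod_zero) (auto simp: in_keys_iff intro!: bexI[of _ i] binomial_eq_0)
qed

lemma seq_binomial_0 [simp]: "seq_binomial p 0 = 1"
  by (simp add: seq_binomial_def)

text \<open>Isolates the one factor that can vary with the degree.\<close>

lemma seq_binomial_drop1:
  "seq_binomial p q = (lookup p 1 choose lookup q 1) * seq_binomial (drop1 p) (drop1 q)"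
proof -
  let ?A = "insert 1 (keys p \<union> keys q)"
  have "seq_binomial p q = (\<Prod>i\<in>?A. lookup p i choose lookup q i)"
    by (rule seq_binomial_superset) auto
  also have "\<dots> = (lookup p 1 choose lookup q 1) * (\<Prod>i\<in>?A - {1}. lookup p i choose lookup q i)"
    by (subst prod.remove[of _ 1]) auto
  also have "(\<Prod>i\<in>?A - {1}. lookup p i choose lookup q i)
      = (\<Prod>i\<in>?A. lookup (drop1 p) i choose lookup (drop1 q) i)"
    by (rule prod.mono_neutral_cong_left) (auto simp: lookup_drop1)
  also have "\<dots> = seq_binomial (drop1 p) (drop1 q)"
    by (rule seq_binomial_superset[symmetric]) (auto simp: in_keys_iff lookup_drop1 split: if_splits)
  finally show ?thesis .
qed

section \<open>Batched form of the recursion\<close>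

lemma exps_within_quantum_int_pos:
  "i > 0 \<Longrightarrow> exps_within (int i - 1) (quantum_int (int i))"
  using exps_within_quantum_int[of "i - 1"] by (cases i) auto

text \<open>Marking an edge of weight \<open>k\<close> contributes \<open>quantum_int k\<close>, of
  width \<open>k - 1\<close>, and lowers I \<beta> - |\<beta>| by exactly that. A floor leaves the
  slack 2 (d - 1 - I (\<beta>' - \<beta>)), which is even and nonnegative. For \<beta> = d e_1 the
  bound is 2 \<delta>.\<close>

lemma exps_within_refined_rel_severi:
  "lookup \<beta> 0 = 0 \<Longrightarrow>
   exps_within (2 * \<delta> + int (seq_weight \<beta>) - int (seq_size \<beta>)) (refined_rel_severi d \<delta> \<alpha> \<beta>)"
proof (induction d \<delta> \<alpha> \<beta> rule: refined_rel_severi.induct)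
  case (1 d \<delta> \<alpha> \<beta>)
  let ?zero = "d = 0 \<or> \<delta> < 0 \<or> int (d * (d + 3) div 2) - int d + int (seq_size \<beta>) - \<delta> \<le> 0"
  let ?one = "d = 1 \<and> \<delta> = 0 \<and> \<alpha> = single 1 1 \<and> \<beta> = 0"
  let ?w = "2 * \<delta> + int (seq_weight \<beta>) - int (seq_size \<beta>)"
  consider ?zero | "\<not> ?zero" ?one | "\<not> ?zero" "\<not> ?one" by blast
  then show ?case
  proof cases
    case 1
    then have "refined_rel_severi d \<delta> \<alpha> \<beta> = 0" by (subst refined_rel_severi.simps) (rule if_P)
    then show ?thesis by simp
  next
    case 2
    then have "refined_rel_severi d \<delta> \<alpha> \<beta> = 1" by (subst refined_rel_severi.simps) simp
    then show ?thesis using 2 by (simp add: exps_within_1)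
  next
    case 3
    have marks: "exps_within ?w (quantum_int (int k) *
        refined_rel_severi d \<delta> (\<alpha> + single k 1) (\<beta> - single k 1))" if k: "k \<in> keys \<beta>" for k
    proof -
      have "k > 0" using k 1(3) by (metis gr0I in_keys_iff)
      have "exps_within (2 * \<delta> + int (seq_weight (\<beta> - single k 1)) - int (seq_size (\<beta> - single k 1)))
          (refined_rel_severi d \<delta> (\<alpha> + single k 1) (\<beta> - single k 1))"
        by (rule 1(1)) (use 3 k 1(3) in \<open>auto simp: lookup_minus\<close>)
      from exps_within_mult[OF exps_within_quantum_int_pos[OF \<open>k > 0\<close>] this]
      show ?thesis
        using seq_size_diff[OF seq_le_single[OF k]] seq_weight_diff[OF seq_le_single[OF k]]
          seq_size_mono[OF seq_le_single[OF k]] seq_weight_mono[OF seq_le_single[OF k]]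
        by (simp add: of_nat_diff algebra_simps)
    qed
    have floors: "exps_within ?w ((\<Prod>i\<in>keys \<beta>'. quantum_int (int i) ^ (lookup \<beta>' i - lookup \<beta> i)) *
          of_nat (seq_binomial \<alpha> \<alpha>') * of_nat (seq_binomial \<beta>' \<beta>) *
          refined_rel_severi (d - 1) (\<delta> - (int d - 1) + int (seq_size (\<beta>' - \<beta>))) \<alpha>' \<beta>')"
      if i: "(\<alpha>', \<beta>') \<in> {(\<alpha>', \<beta>'). seq_le \<alpha>' \<alpha> \<and> seq_le \<beta> \<beta>' \<and> lookup \<beta>' 0 = 0 \<and>
                                seq_weight \<alpha>' + seq_weight \<beta>' = d - 1}" for \<alpha>' \<beta>'
    proof -
      let ?\<delta>' = "\<delta> - (int d - 1) + int (seq_size (\<beta>' - \<beta>))"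
      let ?w1 = "int (seq_weight (\<beta>' - \<beta>)) - int (seq_size (\<beta>' - \<beta>))"
      let ?w2 = "2 * ?\<delta>' + int (seq_weight \<beta>') - int (seq_size \<beta>')"
      have le: "seq_le \<beta> \<beta>'" and \<beta>'0: "lookup \<beta>' 0 = 0" and w: "seq_weight \<alpha>' + seq_weight \<beta>' = d - 1"
        using i by auto
      have keys: "keys (\<beta>' - \<beta>) \<subseteq> keys \<beta>'" by (auto simp: in_keys_iff lookup_minus)
      have "exps_within (\<Sum>i\<in>keys \<beta>'. int (lookup \<beta>' i - lookup \<beta> i) * (int i - 1))
          (\<Prod>i\<in>keys \<beta>'. quantum_int (int i) ^ (lookup \<beta>' i - lookup \<beta> i))"
      proof (rule exps_within_prod[OF exps_within_power[OF exps_within_quantum_int_pos]])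
        show "i > 0" if "i \<in> keys \<beta>'" for i using that \<beta>'0 by (metis gr0I in_keys_iff)
      qed
      also have "(\<Sum>i\<in>keys \<beta>'. int (lookup \<beta>' i - lookup \<beta> i) * (int i - 1)) = ?w1"
        using keys by (simp add: seq_weight_superset[of "keys \<beta>'"] seq_size_superset[of "keys \<beta>'"]
            lookup_minus left_diff_distrib sum_subtractf mult.commute)
      finally have p: "exps_within ?w1 (\<Prod>i\<in>keys \<beta>'. quantum_int (int i) ^ (lookup \<beta>' i - lookup \<beta> i))" .
      have "exps_within ?w2 (refined_rel_severi (d - 1) ?\<delta>' \<alpha>' \<beta>')"
        by (rule 1(2)[OF _ _ i refl]) (use 3 \<beta>'0 in auto)
      from exps_within_mult[OF exps_within_mult[OF exps_within_mult[OF p exps_within_of_nat] exps_within_of_nat] this]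
      have q: "exps_within (?w1 + ?w2) ((\<Prod>i\<in>keys \<beta>'. quantum_int (int i) ^ (lookup \<beta>' i - lookup \<beta> i)) *
          of_nat (seq_binomial \<alpha> \<alpha>') * of_nat (seq_binomial \<beta>' \<beta>) *
          refined_rel_severi (d - 1) ?\<delta>' \<alpha>' \<beta>')" by simp
      have "int (seq_weight \<beta>') = int (seq_weight \<beta>) + int (seq_weight (\<beta>' - \<beta>))"
        "int (seq_size \<beta>') = int (seq_size \<beta>) + int (seq_size (\<beta>' - \<beta>))"
        by (metis seq_le_add_diff[OF le] seq_weight_add of_nat_add, metis seq_le_add_diff[OF le] seq_size_add of_nat_add)
      then have eq: "?w - (?w1 + ?w2) = 2 * (int d - 1 - int (seq_weight (\<beta>' - \<beta>)))" by simp
      have "seq_weight (\<beta>' - \<beta>) \<le> seq_weight \<beta>'" by (rule seq_weight_mono[OF seq_le_diff])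
      then have "int (seq_weight (\<beta>' - \<beta>)) \<le> int d - 1" using w 3 by linarith
      then have "0 \<le> ?w - (?w1 + ?w2)" unfolding eq by simp
      then have le: "?w1 + ?w2 \<le> ?w" by (simp only: diff_ge_0_iff_ge)
      have "even (?w - (?w1 + ?w2))" unfolding eq by (rule dvd_triv_left)
      then show ?thesis by (rule exps_within_mono[OF q le])
    qed
    show ?thesis using 3
      by (subst refined_rel_severi.simps)
        (auto intro!: exps_within_add exps_within_sum marks floors simp del: One_nat_def)
  qed
qed

text \<open>
  With the value \<open>1\<close> at \<open>d = \<delta> = 0\<close>, \<open>\<alpha> = \<beta> = 0\<close> the initial value at \<open>d = 1\<close> becomes an instance of the
  recursion. The condition \<open>\<gamma> > 0\<close> needs no separate treatment, because \<open>\<gamma>\<close> counts the remaining steps.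
\<close>

definition rel_severi :: "nat \<Rightarrow> int \<Rightarrow> sequence \<Rightarrow> sequence \<Rightarrow> rat half_laurent" where
  "rel_severi d \<delta> \<alpha> \<beta> =
    (if d = 0 then if \<delta> = 0 \<and> \<alpha> = 0 \<and> \<beta> = 0 then 1 else 0
     else rat_laurent (refined_rel_severi d \<delta> \<alpha> \<beta>))"

definition floor_index :: "nat \<Rightarrow> sequence \<Rightarrow> sequence \<Rightarrow> (sequence \<times> sequence) set" where
  "floor_index d \<alpha> \<beta> = {(\<alpha>', \<beta>'). seq_le \<alpha>' \<alpha> \<and> seq_le \<beta> \<beta>' \<and> lookup \<beta>' 0 = 0 \<and>
     seq_weight \<alpha>' + seq_weight \<beta>' = d - 1}"

definition floor_sum :: "nat \<Rightarrow> int \<Rightarrow> sequence \<Rightarrow> sequence \<Rightarrow> rat half_laurent" where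
  "floor_sum d \<delta> \<alpha> \<beta> = (\<Sum>(\<alpha>', \<beta>')\<in>floor_index d \<alpha> \<beta>.
     quantum_power (\<beta>' - \<beta>) * of_nat (seq_binomial \<alpha> \<alpha>') * of_nat (seq_binomial \<beta>' \<beta>) *
     rel_severi (d - 1) (\<delta> - (int d - 1) + int (seq_size (\<beta>' - \<beta>))) \<alpha>' \<beta>')"

lemma finite_floor_index: "finite (floor_index d \<alpha> \<beta>)"
proof (rule finite_subset)
  show "floor_index d \<alpha> \<beta> \<subseteq> {s. seq_le s \<alpha>} \<times> {p. lookup p 0 = 0 \<and> seq_weight p \<le> d - 1}"
    by (auto simp: floor_index_def)
qed (intro finite_cartesian_product finite_seq_le finite_seq_weight_le)

lemma rel_severi_neg: "\<delta> < 0 \<Longrightarrow> rel_severi d \<delta> \<alpha> \<beta> = 0"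
  by (simp add: rel_severi_def refined_rel_severi.simps)

lemma rel_severi_no_points:
  "d > 0 \<Longrightarrow> int (d * (d + 3) div 2) - int d + int (seq_size \<beta>) - \<delta> \<le> 0 \<Longrightarrow> rel_severi d \<delta> \<alpha> \<beta> = 0"
  by (simp add: rel_severi_def refined_rel_severi.simps)

lemma seq_weight_eq_0: "lookup p 0 = 0 \<Longrightarrow> seq_weight p = 0 \<Longrightarrow> p = 0"
  using seq_size_le_weight[of p] by simp

lemma seq_remove:
  fixes p :: sequence
  assumes "p \<noteq> 0"
  obtains k q where "k \<in> keys p" "p = q + single k (1::nat)"
proof -
  obtain k where k: "k \<in> keys p" using assms by (metis all_not_in_conv keys_eq_empty)
  then have "p = (p - single k 1) + single k 1"
    using seq_le_add_diff[OF seq_le_single[OF k]] by (simp add: add.commute)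
  with k that show thesis by blast
qed

lemma seq_weight_eq_1: assumes "lookup p 0 = 0" "seq_weight p = 1" shows "p = single 1 1"
proof -
  have "p \<noteq> 0" using assms by auto
  then obtain k q where k: "k \<in> keys p" "p = q + single k (1::nat)" by (rule seq_remove)
  have "k \<noteq> 0" using k(1) assms(1) by (metis in_keys_iff)
  then have "k = 1" "seq_weight q = 0" using k(2) assms(2) by (auto simp: seq_weight_add)
  moreover have "lookup q 0 = 0" using k(2) assms(1) by (simp add: lookup_add)
  ultimately show ?thesis using k(2) seq_weight_eq_0 by simp
qed

text \<open>The recursion without its exceptional cases. Each marking and each floor lowers
  \<open>?\<gamma>\<close> by one, so for \<open>?\<gamma> \<le> 0\<close> all terms on the right
  vanish too; in degree one this is checked directly.\<close>

lemma rel_severi_step: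
  assumes d: "d > 0" and \<delta>: "\<delta> \<ge> 0" and w: "seq_weight \<alpha> + seq_weight \<beta> = d"
    and \<alpha>0: "lookup \<alpha> 0 = 0" and \<beta>0: "lookup \<beta> 0 = 0"
  shows "rel_severi d \<delta> \<alpha> \<beta> =
    (\<Sum>k\<in>keys \<beta>. rat_laurent (quantum_int (int k)) * rel_severi d \<delta> (\<alpha> + single k 1) (\<beta> - single k 1))
    + floor_sum d \<delta> \<alpha> \<beta>"
proof -
  let ?\<gamma> = "int (d * (d + 3) div 2) - int d + int (seq_size \<beta>) - \<delta>"
  let ?one = "d = 1 \<and> \<delta> = 0 \<and> \<alpha> = single 1 1 \<and> \<beta> = 0"
  \<comment> \<open>From degree one a floor can only reach the empty state of degree zero, whose
    value \<open>1\<close> reproduces the initial value.\<close>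
  have index1: "floor_index 1 \<alpha> \<beta> = (if \<beta> = 0 then {(0, 0)} else {})"
  proof -
    have "a = 0 \<and> b = 0 \<and> \<beta> = 0" if "(a, b) \<in> floor_index 1 \<alpha> \<beta>" for a b
    proof -
      have *: "seq_le a \<alpha>" "seq_le \<beta> b" "lookup b 0 = 0" "seq_weight a = 0" "seq_weight b = 0"
        using that by (auto simp: floor_index_def)
      have "lookup a 0 = 0" using *(1) \<alpha>0 by (metis le_zero_eq seq_le_def)
      then have "a = 0" "b = 0" using * seq_weight_eq_0 by blast+
      then show ?thesis using *(2) seq_weight_mono \<beta>0 seq_weight_eq_0
        by (metis le_zero_eq seq_weight_0)
    qed
    then show ?thesis by (force simp: floor_index_def)
  qed
  have floor1: "floor_sum 1 \<delta> \<alpha> \<beta> = (if \<beta> = 0 \<and> \<delta> = 0 then 1 else 0)"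
    unfolding floor_sum_def index1 by (simp add: rel_severi_def)
  consider "?\<gamma> \<le> 0" | "?\<gamma> > 0" ?one | "?\<gamma> > 0" "\<not> ?one" by linarith
  then show ?thesis
  proof cases
    case 1
    have marks: "rel_severi d \<delta> (\<alpha> + single k 1) (\<beta> - single k 1) = 0" if "k \<in> keys \<beta>" for k
      using seq_size_remove_less[OF that] 1 d by (intro rel_severi_no_points) auto
    have floors: "rel_severi (d - 1) (\<delta> - (int d - 1) + int (seq_size (\<beta>' - \<beta>))) \<alpha>' \<beta>' = 0"
      if "(\<alpha>', \<beta>') \<in> floor_index d \<alpha> \<beta>" and "d \<noteq> 1" for \<alpha>' \<beta>'
    proof (rule rel_severi_no_points)
      have le: "seq_le \<beta> \<beta>'" using that by (auto simp: floor_index_def)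
      obtain e where e: "d = Suc e" using d by (metis gr0_conv_Suc)
      have s: "int (seq_size \<beta>') = int (seq_size \<beta>) + int (seq_size (\<beta>' - \<beta>))"
        by (metis seq_le_add_diff[OF le] seq_size_add of_nat_add)
      have "d * (d + 3) = e * (e + 3) + 2 * (e + 2)" unfolding e by (simp add: algebra_simps)
      then have "d * (d + 3) div 2 = e * (e + 3) div 2 + (e + 2)" by simp
      then show "int ((d - 1) * (d - 1 + 3) div 2) - int (d - 1) + int (seq_size \<beta>')
          - (\<delta> - (int d - 1) + int (seq_size (\<beta>' - \<beta>))) \<le> 0"
        using 1 s e by simp
    qed (use that d in auto)
    have "floor_sum d \<delta> \<alpha> \<beta> = 0"
    proof (cases "d = 1")
      case True
      then show ?thesis using floor1 1 by auto
    next
      case False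
      then show ?thesis unfolding floor_sum_def by (intro sum.neutral) (auto simp: floors[simplified])
    qed
    then show ?thesis using 1 d marks by (simp add: rel_severi_no_points)
  next
    case 2
    have "refined_rel_severi d \<delta> \<alpha> \<beta> = 1"
      using 2 by (subst refined_rel_severi.simps) simp
    then show ?thesis using 2 floor1 by (simp add: rel_severi_def)
  next
    case 3
    have "rel_severi d \<delta> \<alpha> \<beta> = rat_laurent (refined_rel_severi d \<delta> \<alpha> \<beta>)"
      using d by (simp add: rel_severi_def)
    also have "\<dots> = (\<Sum>k\<in>keys \<beta>. rat_laurent (quantum_int (int k)) * rel_severi d \<delta> (\<alpha> + single k 1) (\<beta> - single k 1))
      + (\<Sum>(\<alpha>', \<beta>')\<in>floor_index d \<alpha> \<beta>. rat_laurent
          ((\<Prod>i\<in>keys \<beta>'. quantum_int (int i) ^ (lookup \<beta>' i - lookup \<beta> i)) *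
          of_nat (seq_binomial \<alpha> \<alpha>') * of_nat (seq_binomial \<beta>' \<beta>) *
          refined_rel_severi (d - 1) (\<delta> - (int d - 1) + int (seq_size (\<beta>' - \<beta>))) \<alpha>' \<beta>'))"
      using 3 \<delta> d by (subst refined_rel_severi.simps)
        (auto simp: rat_laurent_add rat_laurent_sum rat_laurent_mult rel_severi_def floor_index_def
          split_def simp del: One_nat_def)
    also have "(\<Sum>(\<alpha>', \<beta>')\<in>floor_index d \<alpha> \<beta>. rat_laurent
          ((\<Prod>i\<in>keys \<beta>'. quantum_int (int i) ^ (lookup \<beta>' i - lookup \<beta> i)) *
          of_nat (seq_binomial \<alpha> \<alpha>') * of_nat (seq_binomial \<beta>' \<beta>) *
          refined_rel_severi (d - 1) (\<delta> - (int d - 1) + int (seq_size (\<beta>' - \<beta>))) \<alpha>' \<beta>')) = floor_sum d \<delta> \<alpha> \<beta>"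
    proof (cases "d = 1")
      case True
      \<comment> \<open>With \<beta> = 0 the weight condition forces \<alpha> = e_1, which together
        with \<delta> = 0 is the excluded initial state. Hence the new value in degree zero does not
        enter here.\<close>
      have "\<not> (\<beta> = 0 \<and> \<delta> = 0)"
        using 3(2) True w \<alpha>0 seq_weight_eq_1[of \<alpha>] by auto
      then show ?thesis using floor1 True
        by (simp add: refined_rel_severi.simps sum.neutral)
    next
      case False
      show ?thesis unfolding floor_sum_def
      proof (intro sum.cong refl, safe)
        fix \<alpha>' \<beta>'
        have "quantum_power (\<beta>' - \<beta>) = (\<Prod>i\<in>keys \<beta>'. rat_laurent (quantum_int (int i)) ^ lookup (\<beta>' - \<beta>) i)"
          by (rule quantum_power_superset) (auto simp: in_keys_iff lookup_minus)
        then show "rat_laurent ((\<Prod>i\<in>keys \<beta>'. quantum_int (int i) ^ (lookup \<beta>' i - lookup \<beta> i)) *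
          of_nat (seq_binomial \<alpha> \<alpha>') * of_nat (seq_binomial \<beta>' \<beta>) *
          refined_rel_severi (d - 1) (\<delta> - (int d - 1) + int (seq_size (\<beta>' - \<beta>))) \<alpha>' \<beta>') =
          quantum_power (\<beta>' - \<beta>) * of_nat (seq_binomial \<alpha> \<alpha>') * of_nat (seq_binomial \<beta>' \<beta>) *
          rel_severi (d - 1) (\<delta> - (int d - 1) + int (seq_size (\<beta>' - \<beta>))) \<alpha>' \<beta>'"
          using False d by (simp add: rat_laurent_mult rat_laurent_prod rat_laurent_power
              rat_laurent_of_nat rel_severi_def lookup_minus)
      qed
    qed
    finally show ?thesis .
  qed
qed

text \<open>Unrolls the markings up to the next floor: \<open>s\<close> collects the marked edges,
  and \<open>multinomial s\<close> counts the orders of marking them. The induction on |\<beta>|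
  removes the edge marked first.\<close>

lemma rel_severi_batch:
  assumes d: "d > 0" and \<delta>: "\<delta> \<ge> 0"
    and "seq_weight \<alpha> + seq_weight \<beta> = d" "lookup \<alpha> 0 = 0" "lookup \<beta> 0 = 0"
  shows "rel_severi d \<delta> \<alpha> \<beta> =
    (\<Sum>s | seq_le s \<beta>. const (multinomial s) * quantum_power s * floor_sum d \<delta> (\<alpha> + s) (\<beta> - s))"
  using assms(3-)
proof (induction "seq_size \<beta>" arbitrary: \<alpha> \<beta> rule: less_induct)
  case less
  define G where "G s = quantum_power s * floor_sum d \<delta> (\<alpha> + s) (\<beta> - s)" for s
  have mark: "rat_laurent (quantum_int (int k)) * rel_severi d \<delta> (\<alpha> + single k 1) (\<beta> - single k 1)
     = (\<Sum>s | seq_le s \<beta> \<and> k \<in> keys s. const (multinomial (s - single k 1)) * G s)"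
    if k: "k \<in> keys \<beta>" for k
  proof -
    have le: "seq_le (single k 1) \<beta>" by (rule seq_le_single[OF k])
    have "k \<noteq> 0" using k less.prems(3) by (metis in_keys_iff)
    have wt: "seq_weight (\<beta> - single k 1) = seq_weight \<beta> - k" "k \<le> seq_weight \<beta>"
      using seq_weight_diff[OF le] seq_weight_mono[OF le] by simp_all
    have "rel_severi d \<delta> (\<alpha> + single k 1) (\<beta> - single k 1) =
      (\<Sum>s | seq_le s (\<beta> - single k 1). const (multinomial s) * quantum_power s *
        floor_sum d \<delta> (\<alpha> + single k 1 + s) (\<beta> - single k 1 - s))"
      by (rule less.hyps[OF seq_size_remove_less[OF k]])
        (use wt less.prems \<open>k \<noteq> 0\<close> in \<open>simp_all add: seq_weight_add lookup_add lookup_minus lookup_single when_def\<close>)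
    then have "rat_laurent (quantum_int (int k)) * rel_severi d \<delta> (\<alpha> + single k 1) (\<beta> - single k 1) =
      (\<Sum>s | seq_le s (\<beta> - single k 1). const (multinomial s) * G (s + single k 1))"
      by (simp add: sum_distrib_left G_def quantum_power_add quantum_power_single algebra_simps
          diff_diff_eq)
    \<comment> \<open>The first marked edge \<open>k\<close> is put back into the collection of
      marked edges.\<close>
    also have "\<dots> = (\<Sum>s | seq_le s \<beta> \<and> k \<in> keys s. const (multinomial (s - single k 1)) * G s)"
    proof (rule sum.reindex_bij_witness[of _ "\<lambda>s. s - single k 1" "\<lambda>s. s + single k 1"])
      fix s assume s: "s \<in> {s. seq_le s \<beta> \<and> k \<in> keys s}"
      then show "s - single k 1 + single k 1 = s"
        using seq_le_add_diff[OF seq_le_single, of k s] by (simp add: add.commute)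
      show "s - single k 1 \<in> {s. seq_le s (\<beta> - single k 1)}"
        using s by (auto simp: seq_le_def lookup_minus intro: diff_le_mono)
    next
      fix s assume s: "s \<in> {s. seq_le s (\<beta> - single k 1)}"
      have "lookup s i + lookup (single k 1) i \<le> lookup \<beta> i" for i
      proof -
        have "lookup s i \<le> lookup \<beta> i - lookup (single k 1) i"
          using s by (auto simp: seq_le_def lookup_minus)
        moreover have "lookup (single k 1) i \<le> lookup \<beta> i" using le by (simp add: seq_le_def)
        ultimately show ?thesis by linarith
      qed
      then show "s + single k 1 \<in> {s. seq_le s \<beta> \<and> k \<in> keys s}"
        by (auto simp: seq_le_def lookup_add in_keys_iff)
    qed auto
    finally show ?thesis .
  qed
  have zero: "floor_sum d \<delta> \<alpha> \<beta> = G 0" by (simp add: G_def)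
  have "(\<Sum>s | seq_le s \<beta>. const (multinomial s) * quantum_power s * floor_sum d \<delta> (\<alpha> + s) (\<beta> - s))
    = (\<Sum>s | seq_le s \<beta>. const (multinomial s) * G s)"
    by (simp add: G_def mult.assoc)
  also have "\<dots> = G 0 + (\<Sum>s\<in>{s. seq_le s \<beta>} - {0}. const (multinomial s) * G s)"
    by (subst sum.remove[of _ 0]) (auto simp: finite_seq_le)
  also have "(\<Sum>s\<in>{s. seq_le s \<beta>} - {0}. const (multinomial s) * G s)
    = (\<Sum>s\<in>{s. seq_le s \<beta>} - {0}. \<Sum>k\<in>keys s. const (multinomial (s - single k 1)) * G s)"
    by (rule sum.cong) (auto simp: multinomial_rec const_sum sum_distrib_right)
  also have "\<dots> = (\<Sum>s | seq_le s \<beta>. \<Sum>k\<in>keys s. const (multinomial (s - single k 1)) * G s)"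
    by (rule sum.mono_neutral_left) (auto simp: finite_seq_le)
  also have "\<dots> = (\<Sum>s | seq_le s \<beta>. \<Sum>k | k \<in> keys \<beta> \<and> k \<in> keys s. const (multinomial (s - single k 1)) * G s)"
  proof (rule sum.cong[OF refl])
    fix s assume "s \<in> {s. seq_le s \<beta>}"
    then have "keys s = {k. k \<in> keys \<beta> \<and> k \<in> keys s}"
      by (auto simp: in_keys_iff seq_le_def) (metis less_le_trans)
    then show "(\<Sum>k\<in>keys s. const (multinomial (s - single k 1)) * G s) =
      (\<Sum>k | k \<in> keys \<beta> \<and> k \<in> keys s. const (multinomial (s - single k 1)) * G s)" by simp
  qed
  \<comment> \<open>Summing first over \<open>s\<close> groups the orders of marking by their first
    edge, which gives the marking terms of the recursion.\<close>
  also have "\<dots> = (\<Sum>k\<in>keys \<beta>. \<Sum>s | s \<in> {s. seq_le s \<beta>} \<and> k \<in> keys s. const (multinomial (s - single k 1)) * G s)"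
    by (rule sum.swap_restrict) (auto simp: finite_seq_le)
  also have "\<dots> = (\<Sum>k\<in>keys \<beta>. rat_laurent (quantum_int (int k)) * rel_severi d \<delta> (\<alpha> + single k 1) (\<beta> - single k 1))"
    by (rule sum.cong) (simp_all add: mark del: One_nat_def)
  finally show ?case
    using rel_severi_step[OF d \<delta> less.prems] zero by (simp add: add.commute)
qed

section \<open>Polynomial dependence on a natural number\<close>

text \<open>\<open>L\<close> is the coefficient at \<open>D\<close> and may be zero, so
  \<open>D\<close> only bounds the degree. This makes the notion additive and lets terms of lower
  degree enter sums with \<open>L = 0\<close>.\<close>

definition poly_from :: "nat \<Rightarrow> nat \<Rightarrow> rat half_laurent \<Rightarrow> (nat \<Rightarrow> rat half_laurent) \<Rightarrow> bool" where
  "poly_from n D L f \<longleftrightarrow> (\<exists>P. degree P \<le> D \<and> coeff P D = L \<and> (\<forall>j\<ge>n. f j = poly P (of_nat j)))"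

lemma poly_from_add:
  assumes "poly_from n D L f" "poly_from n D M g"
  shows "poly_from n D (L + M) (\<lambda>j. f j + g j)"
proof -
  obtain P Q where "degree P \<le> D" "coeff P D = L" "\<forall>j\<ge>n. f j = poly P (of_nat j)"
    "degree Q \<le> D" "coeff Q D = M" "\<forall>j\<ge>n. g j = poly Q (of_nat j)"
    using assms by (auto simp: poly_from_def)
  then show ?thesis unfolding poly_from_def
    by (intro exI[of _ "P + Q"]) (auto intro: degree_add_le)
qed

lemma poly_from_zero: "poly_from n D 0 (\<lambda>_. 0)"
  unfolding poly_from_def by (intro exI[of _ 0]) auto

lemma poly_from_sum:
  "(\<And>i. i \<in> I \<Longrightarrow> poly_from n D (L i) (f i)) \<Longrightarrow> poly_from n D (sum L I) (\<lambda>j. \<Sum>i\<in>I. f i j)"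
  by (induction I rule: infinite_finite_induct) (auto intro: poly_from_zero poly_from_add)

lemma poly_from_const: "poly_from n 0 c (\<lambda>_. c)"
  unfolding poly_from_def by (intro exI[of _ "[:c:]"]) auto

lemma poly_from_mult:
  assumes "poly_from n D L f" "poly_from n E M g"
  shows "poly_from n (D + E) (L * M) (\<lambda>j. f j * g j)"
proof -
  obtain P Q where PQ: "degree P \<le> D" "coeff P D = L" "\<forall>j\<ge>n. f j = poly P (of_nat j)"
    "degree Q \<le> E" "coeff Q E = M" "\<forall>j\<ge>n. g j = poly Q (of_nat j)"
    using assms by (auto simp: poly_from_def)
  have "coeff (P * Q) (D + E) = (\<Sum>i\<le>D + E. if i = D then coeff P D * coeff Q E else 0)"
    unfolding coeff_mult
  proof (intro sum.cong refl)
    fix i assume "i \<in> {..D + E}"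
    then consider "i = D" | "degree P < i" | "degree Q < D + E - i" using PQ by fastforce
    then show "coeff P i * coeff Q (D + E - i) = (if i = D then coeff P D * coeff Q E else 0)"
      by cases (use PQ in \<open>auto simp: coeff_eq_0\<close>)
  qed
  then have "coeff (P * Q) (D + E) = L * M" using PQ by simp
  moreover have "degree (P * Q) \<le> D + E"
    using degree_mult_le[of P Q] PQ by linarith
  ultimately show ?thesis unfolding poly_from_def
    using PQ by (intro exI[of _ "P * Q"]) auto
qed

lemma poly_from_cmult: "poly_from n D L f \<Longrightarrow> poly_from n D (c * L) (\<lambda>j. c * f j)"
  using poly_from_mult[OF poly_from_const[of n c]] by simp

lemma poly_from_less_degree: "poly_from n D L f \<Longrightarrow> D < E \<Longrightarrow> poly_from n E 0 f"
  unfolding poly_from_def by (metis coeff_eq_0 le_less_trans less_imp_le)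

lemma poly_from_mono: "poly_from n D L f \<Longrightarrow> n \<le> m \<Longrightarrow> poly_from m D L f"
  unfolding poly_from_def using order_trans[of n m] by blast

lemma poly_from_cong: "poly_from n D L f \<Longrightarrow> (\<And>j. j \<ge> n \<Longrightarrow> g j = f j) \<Longrightarrow> poly_from n D L g"
  unfolding poly_from_def by auto

text \<open>Substituting x - 1 keeps degree and top coefficient. The threshold rises by one so that
  \<open>j - 1\<close> stays at least \<open>n\<close>.\<close>

lemma poly_from_shift:
  assumes "poly_from n D L f"
  shows "poly_from (Suc n) D L (\<lambda>j. f (j - 1))"
proof -
  obtain P where P: "degree P \<le> D" "coeff P D = L" "\<forall>j\<ge>n. f j = poly P (of_nat j)"
    using assms by (auto simp: poly_from_def)
  let ?Q = "pcompose P [:-1, 1:]"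
  have deg: "degree ?Q = degree P" by (simp add: degree_pcompose)
  have "coeff ?Q D = L"
  proof (cases "degree P = D")
    case True
    then show ?thesis using lead_coeff_comp[of "[:-1, 1:]" P] P deg by simp
  next
    case False
    then show ?thesis using P deg by (metis coeff_eq_0 le_neq_implies_less)
  qed
  moreover have "f (j - 1) = poly ?Q (of_nat j)" if "j \<ge> Suc n" for j
    using P(3) that by (auto simp: poly_pcompose of_nat_diff)
  ultimately show ?thesis unfolding poly_from_def using P deg by (intro exI[of _ ?Q]) auto
qed

lemma poly_from_linear: "poly_from n 1 1 (\<lambda>j. of_nat j + c)"
  unfolding poly_from_def by (intro exI[of _ "[:c, 1:]"]) (auto simp: add.commute)

lemma poly_from_prod_linear: "poly_from n k 1 (\<lambda>j. \<Prod>i<k. of_nat j + c i)"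
proof (induction k)
  case 0
  show ?case using poly_from_const[of n 1] by simp
next
  case (Suc k)
  from poly_from_mult[OF Suc poly_from_linear[of n "c k"]]
  show ?case by simp
qed

lemma const_prod: "const (prod f I) = (\<Prod>i\<in>I. const (f i))"
  by (induction I rule: infinite_finite_induct) (auto simp: const_mult)

text \<open>The generalized coefficient is a product of \<open>k\<close> linear factors in
  \<open>j\<close> over \<open>k!\<close>, also where its upper argument is negative.\<close>

lemma poly_from_gbinomial:
  "poly_from n k (const (1 / fact k)) (\<lambda>j. const ((of_nat j + q) gchoose k))"
proof -
  have "const ((of_nat j + q) gchoose k) = const (1 / fact k) * (\<Prod>i<k. of_nat j + const (q - of_nat i))" for j
  proof -
    have "((of_nat j + q) gchoose k) = 1 / fact k * (\<Prod>i<k. of_nat j + (q - of_nat i))"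
      by (simp add: gbinomial_prod_rev algebra_simps atLeast0LessThan)
    then have "const ((of_nat j + q) gchoose k) = const (1 / fact k) * const (\<Prod>i<k. of_nat j + (q - of_nat i))"
      by (simp only: const_mult)
    then show ?thesis by (simp only: const_prod single_add single_of_nat)
  qed
  then show ?thesis using poly_from_cmult[OF poly_from_prod_linear, where c = "const (1 / fact k)"] by simp
qed

text \<open>The basis of rising factorials \<open>x (x + 1) \<dots> (x + k)\<close> has backward differences
  \<open>(k + 1) x \<dots> (x + k - 1)\<close>.\<close>

lemma poly_antidifference:
  fixes Q :: "rat half_laurent poly"
  assumes "degree Q \<le> k"
  shows "\<exists>P. degree P \<le> Suc k \<and> coeff P (Suc k) = const (1 / of_nat (Suc k)) * coeff Q k \<and>
    (\<forall>x. poly P x - poly P (x - 1) = poly Q x)"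
  using assms
proof (induction k arbitrary: Q)
  case 0
  then obtain c where "Q = [:c:]" by (metis degree_0_id le_zero_eq)
  then show ?case by (intro exI[of _ "[:0, c:]"]) (auto simp: algebra_simps)
next
  case (Suc k)
  define B :: "nat \<Rightarrow> rat half_laurent poly" where "B m = (\<Prod>i<m. [:of_nat i, 1:])" for m
  have degB: "degree (B m) = m" and leadB: "coeff (B m) m = 1" for m
  proof -
    show d: "degree (B m) = m" unfolding B_def by (subst degree_prod_eq_sum_degree) auto
    have "lead_coeff (B m) = 1" unfolding B_def by (subst lead_coeff_prod) simp
    then show "coeff (B m) m = 1" using d by simp
  qed
  have diffB: "poly (B (Suc m)) x - poly (B (Suc m)) (x - 1) = of_nat (Suc m) * poly (B m) x" for m x
  proof -
    have "poly (B (Suc m)) (x - 1) = (x - 1) * poly (B m) x"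
      unfolding B_def by (simp add: poly_prod prod.lessThan_Suc_shift algebra_simps del: prod.lessThan_Suc)
    moreover have "poly (B (Suc m)) x = (x + of_nat m) * poly (B m) x"
      unfolding B_def by (simp add: poly_prod algebra_simps)
    ultimately show ?thesis by (simp add: algebra_simps)
  qed
  let ?c = "coeff Q (Suc k)"
  \<comment> \<open>Removing the top term in the rising factorial basis lowers the degree; its
    antidifference, a multiple of \<open>B (Suc (Suc k))\<close>, is added back below.\<close>
  let ?Q = "Q - smult ?c (B (Suc k))"
  have "degree ?Q \<le> Suc k" using Suc.prems degB by (intro degree_diff_le) (auto intro: order_trans[OF degree_smult_le])
  moreover have "coeff ?Q (Suc k) = 0" using leadB by simp
  ultimately have "degree ?Q \<le> k"
    by (metis leading_coeff_0_iff le_SucE degree_0 zero_le)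
  then obtain P where P: "degree P \<le> Suc k" "\<And>x. poly P x - poly P (x - 1) = poly ?Q x"
    using Suc.IH by blast
  let ?d = "const (1 / of_nat (Suc (Suc k)))"
  let ?P = "P + smult (?d * ?c) (B (Suc (Suc k)))"
  have d: "?d * of_nat (Suc (Suc k)) = 1"
    by (metis const_mult const_of_nat nonzero_eq_divide_eq of_nat_neq_0 single_one)
  have "degree ?P \<le> Suc (Suc k)"
    using P degB by (intro degree_add_le) (auto intro: order_trans[OF degree_smult_le])
  moreover have "coeff ?P (Suc (Suc k)) = ?d * ?c"
    using P(1) leadB by (simp add: coeff_eq_0)
  moreover have "poly ?P x - poly ?P (x - 1) = poly Q x" for x
  proof -
    have "poly ?P x - poly ?P (x - 1) = (poly P x - poly P (x - 1))
        + ?d * ?c * (poly (B (Suc (Suc k))) x - poly (B (Suc (Suc k))) (x - 1))"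
      by (simp only: poly_add poly_smult right_diff_distrib) simp
    also have "\<dots> = poly ?Q x + (?d * of_nat (Suc (Suc k))) * ?c * poly (B (Suc k)) x"
      unfolding diffB P(2) by (simp only: mult_ac)
    also have "\<dots> = poly Q x" unfolding d by simp
    finally show ?thesis .
  qed
  ultimately show ?case by (intro exI[of _ ?P]) blast
qed

text \<open>The difference equation at \<open>Suc n\<close> already involves \<open>f n\<close>, so
  summation lowers the threshold by one. This compensates the loss in
  \<open>poly_from_shift\<close>.\<close>

lemma poly_from_antidifference:
  assumes "poly_from (Suc n) D L (\<lambda>j. f j - f (j - 1))"
  shows "poly_from n (Suc D) (const (1 / of_nat (Suc D)) * L) f"
proof -
  obtain Q where Q: "degree Q \<le> D" "coeff Q D = L" "\<forall>j\<ge>Suc n. f j - f (j - 1) = poly Q (of_nat j)"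
    using assms by (auto simp: poly_from_def)
  obtain P where P: "degree P \<le> Suc D" "coeff P (Suc D) = const (1 / of_nat (Suc D)) * L"
    "\<And>x. poly P x - poly P (x - 1) = poly Q x"
    using poly_antidifference[OF Q(1)] Q(2) by blast
  \<comment> \<open>The constant of summation is chosen to make the two sides agree at
    \<open>n\<close>.\<close>
  let ?P = "P + [:f n - poly P (of_nat n):]"
  have "f j = poly ?P (of_nat j)" if "j \<ge> n" for j
    using that
  proof (induction j rule: dec_induct)
    case (step j)
    have "f (Suc j) = f j + poly Q (of_nat (Suc j))" using Q(3) step by (force simp: algebra_simps)
    also have "poly Q (of_nat (Suc j)) = poly P (of_nat (Suc j)) - poly P (of_nat (Suc j) - 1)"
      by (simp only: P(3))
    also have "of_nat (Suc j) - 1 = (of_nat j :: rat half_laurent)" by simp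
    finally show ?case using step by (simp only: poly_add) simp
  qed simp
  moreover have "degree ?P \<le> Suc D" using P(1) by (intro degree_add_le) auto
  moreover have "coeff ?P (Suc D) = const (1 / of_nat (Suc D)) * L" using P(2) by simp
  ultimately show ?thesis unfolding poly_from_def by blast
qed

lemma lookup_poly_of_nat:
  fixes P :: "'a::comm_ring_1 half_laurent poly"
  assumes "degree P \<le> D"
  shows "lookup (poly P (of_nat j)) n = (\<Sum>i\<le>D. lookup (coeff P i) n * of_nat j ^ i)"
proof -
  have "poly P (of_nat j) = (\<Sum>i\<le>D. coeff P i * of_nat (j ^ i))"
    unfolding poly_altdef of_nat_power
    by (rule sum.mono_neutral_left) (use assms in \<open>auto simp: coeff_eq_0\<close>)
  then show ?thesis by (simp add: lookup_sum lookup_mult_of_nat del: of_nat_power) simp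
qed

text \<open>For a fixed forbidden exponent the coefficients form a rational polynomial in
  \<open>j\<close> with infinitely many zeros.\<close>

lemma exps_within_coeff:
  fixes P :: "rat half_laurent poly"
  assumes "\<And>j. j \<ge> n \<Longrightarrow> exps_within w (poly P (of_nat j))"
  shows "exps_within w (coeff P i)"
  unfolding exps_within_def
proof (intro allI impI, rule ccontr)
  fix e assume nz: "lookup (coeff P i) e \<noteq> 0" and bad: "\<not> (\<bar>e\<bar> \<le> w \<and> even (e + w))"
  define p where "p = (\<Sum>i\<le>degree P. monom (lookup (coeff P i) e) i)"
  have "coeff p i = lookup (coeff P i) e" for i
    by (simp add: p_def coeff_sum coeff_eq_0)
  then have "p \<noteq> 0" using nz by (metis coeff_0)
  have "poly p (of_nat j) = 0" if "j \<ge> n" for j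
  proof -
    have "poly p (of_nat j) = lookup (poly P (of_nat j)) e"
      by (simp add: p_def poly_sum poly_monom lookup_poly_of_nat[OF order_refl])
    also have "\<dots> = 0" using assms[OF that] bad by (auto simp: exps_within_def)
    finally show ?thesis .
  qed
  then have "of_nat ` {n..} \<subseteq> {x. poly p x = 0}" by auto
  moreover have "infinite (of_nat ` {n..} :: rat set)"
    by (simp add: finite_image_iff infinite_Ici inj_on_def)
  ultimately show False using poly_roots_finite[OF \<open>p \<noteq> 0\<close>] finite_subset by blast
qed

section \<open>Transitions between floors\<close>

text \<open>Only weights at least two are recorded in \<nu>; the number of edges of weight one is
  determined by the degree.\<close>

definition normal_seq :: "sequence \<Rightarrow> bool" where
  "normal_seq \<nu> \<longleftrightarrow> lookup \<nu> 0 = 0 \<and> lookup \<nu> 1 = 0"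

text \<open>The distance of a state from the normal state. It enters both the cost of arriving there
  and the threshold; the subtraction does not truncate for normal \<nu>, where |\<nu>| is at most I
  \<nu>.\<close>

definition excess :: "sequence \<Rightarrow> sequence \<Rightarrow> nat" where
  "excess \<alpha> \<nu> = seq_weight \<alpha> + (seq_weight \<nu> - seq_size \<nu>)"

definition state_severi :: "nat \<Rightarrow> sequence \<Rightarrow> sequence \<Rightarrow> nat \<Rightarrow> rat half_laurent" where
  "state_severi \<delta> \<alpha> \<nu> j = (if seq_weight \<alpha> + seq_weight \<nu> \<le> j
     then rel_severi j (int \<delta>) \<alpha> (single 1 (j - seq_weight \<alpha> - seq_weight \<nu>) + \<nu>) else 0)"

text \<open>
  A transition \<open>(a, \<rho>, \<alpha>', \<nu>')\<close> leaves the edges \<open>a e_1 + \<rho>\<close> of \<open>\<beta>\<close> unmarked before the floor and arrives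
  at the state \<open>(\<alpha>', \<nu>')\<close> after it.
\<close>

fun cost :: "nat \<times> sequence \<times> sequence \<times> sequence \<Rightarrow> nat" where
  "cost (a, \<rho>, \<alpha>, \<nu>) = excess \<alpha> \<nu> + a + seq_size \<rho>"

text \<open>The departing state does not occur, so one finite set serves all of them. That \<rho> is
  available at departure is tested in \<open>transition_coeff\<close>.\<close>

definition transitions :: "nat \<Rightarrow> (nat \<times> sequence \<times> sequence \<times> sequence) set" where
  "transitions \<delta> = {(a, \<rho>, \<alpha>, \<nu>). lookup \<alpha> 0 = 0 \<and> normal_seq \<nu> \<and> seq_le \<rho> \<nu> \<and> cost (a, \<rho>, \<alpha>, \<nu>) \<le> \<delta>}"

text \<open>With m and m' edges of weight one before and after, the three generalized coefficients
  are (m - a + |\<nu> - \<rho>| choose |\<nu> - \<rho>|) for the order of marking, (\<alpha>_1 + m -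
  a choose \<alpha>'_1) for the marked edges kept, and (m' choose a) for the unmarked edges
  kept.\<close>

fun transition_coeff :: "sequence \<Rightarrow> sequence \<Rightarrow> nat \<times> sequence \<times> sequence \<times> sequence \<Rightarrow> nat \<Rightarrow> rat half_laurent" where
  "transition_coeff \<alpha> \<nu> (a, \<rho>, \<alpha>', \<nu>') j = (if seq_le \<rho> \<nu> then
     (const (multinomial (\<nu> - \<rho>)) * quantum_power (\<nu> - \<rho>) * quantum_power (\<nu>' - \<rho>) *
      of_nat (seq_binomial (drop1 \<alpha> + (\<nu> - \<rho>)) (drop1 \<alpha>')) * of_nat (seq_binomial \<nu>' \<rho>)) *
     const ((of_nat j + (of_nat (seq_size (\<nu> - \<rho>)) - of_nat (seq_weight \<alpha> + seq_weight \<nu> + a)))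
       gchoose seq_size (\<nu> - \<rho>)) *
     const ((of_nat j + (of_nat (lookup \<alpha> 1) - of_nat (seq_weight \<alpha> + seq_weight \<nu> + a))) gchoose lookup \<alpha>' 1) *
     const ((of_nat j + (- of_nat (1 + seq_weight \<alpha>' + seq_weight \<nu>'))) gchoose a)
   else 0)"

lemma normal_seq_weight: "normal_seq \<nu> \<Longrightarrow> 2 * seq_size \<nu> \<le> seq_weight \<nu>"
  unfolding seq_size_def seq_weight_def sum_distrib_left
proof (intro sum_mono)
  fix i assume "normal_seq \<nu>" "i \<in> keys \<nu>"
  then have "i \<noteq> 0" "i \<noteq> 1" by (auto simp: normal_seq_def in_keys_iff intro: ccontr)
  then show "2 * lookup \<nu> i \<le> i * lookup \<nu> i" by simp
qed

lemma normal_seq_0 [simp]: "normal_seq 0"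
  by (simp add: normal_seq_def)

lemma normal_seq_le: "seq_le \<rho> \<nu> \<Longrightarrow> normal_seq \<nu> \<Longrightarrow> normal_seq \<rho>"
  by (metis le_zero_eq normal_seq_def seq_le_def)

lemma drop1_normal: "normal_seq \<nu> \<Longrightarrow> drop1 \<nu> = \<nu>"
  by (simp add: drop1_ident normal_seq_def)

text \<open>Since all weights in \<nu> are at least two, I \<nu> is at most 2 (I \<nu> - |\<nu>|),
  which the cost controls.\<close>

lemma finite_transitions: "finite (transitions \<delta>)"
proof (rule finite_subset)
  let ?S = "{p. lookup p 0 = 0 \<and> seq_weight p \<le> 2 * \<delta>}"
  show "transitions \<delta> \<subseteq> {..\<delta>} \<times> ?S \<times> ?S \<times> ?S"
  proof safe
    fix a \<rho> \<alpha> \<nu> assume "(a, \<rho>, \<alpha>, \<nu>) \<in> transitions \<delta>"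
    then have *: "lookup \<alpha> 0 = 0" "normal_seq \<nu>" "seq_le \<rho> \<nu>" "cost (a, \<rho>, \<alpha>, \<nu>) \<le> \<delta>"
      by (auto simp: transitions_def)
    show "a \<le> \<delta>" "lookup \<alpha> 0 = 0" "seq_weight \<alpha> \<le> 2 * \<delta>" using * by (auto simp: excess_def)
    show "lookup \<nu> 0 = 0" "lookup \<rho> 0 = 0"
      using *(2) normal_seq_le[OF *(3,2)] by (auto simp: normal_seq_def)
    show "seq_weight \<nu> \<le> 2 * \<delta>"
      using normal_seq_weight[OF *(2)] *(4) by (simp add: excess_def)
    then show "seq_weight \<rho> \<le> 2 * \<delta>" using seq_weight_mono[OF *(3)] by linarith
  qed
qed (intro finite_cartesian_product finite_seq_weight_le finite_atMost)

text \<open>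
  Fewer than \<open>a\<close> edges of weight one are available here. The bound on \<open>j\<close> makes the upper argument of the
  first binomial coefficient a natural number below its lower one.
\<close>

lemma transition_coeff_eq_0:
  assumes le: "seq_le \<rho> \<nu>" and j: "\<delta> + excess \<alpha> \<nu> \<le> j" and c: "a + seq_size \<rho> \<le> \<delta>"
    and size: "seq_size \<nu> \<le> seq_weight \<nu>"
    and small: "j < seq_weight \<alpha> + seq_weight \<nu> + a"
  shows "transition_coeff \<alpha> \<nu> (a, \<rho>, \<alpha>', \<nu>') j = 0"
proof -
  let ?n = "seq_size (\<nu> - \<rho>)"
  have n: "?n = seq_size \<nu> - seq_size \<rho>" "seq_size \<rho> \<le> seq_size \<nu>"
    using seq_size_diff[OF le] seq_size_mono[OF le] by auto
  define N where "N = j + ?n - (seq_weight \<alpha> + seq_weight \<nu> + a)"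
  \<comment> \<open>The summand - |\<nu>| in the threshold cancels against |\<nu> - \<rho>| =
    |\<nu>| - |\<rho>|, and a + |\<rho>| is at most \<delta>.\<close>
  have ge: "seq_weight \<alpha> + seq_weight \<nu> + a \<le> j + ?n"
    using j c n size by (simp add: excess_def)
  have "N < ?n" using ge small by (simp add: N_def)
  have "of_nat j + (of_nat ?n - of_nat (seq_weight \<alpha> + seq_weight \<nu> + a)) = (of_nat N :: rat)"
    using ge unfolding N_def by (simp add: of_nat_diff)
  then have "((of_nat j + (of_nat ?n - of_nat (seq_weight \<alpha> + seq_weight \<nu> + a)) :: rat) gchoose ?n) = 0"
    using \<open>N < ?n\<close> by (simp only: binomial_gbinomial[symmetric]) (simp add: binomial_eq_0)
  then show ?thesis by (simp only: transition_coeff.simps) simp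
qed

text \<open>One batch of markings followed by one floor, rewritten in terms of states. When
  \<open>j\<close> is too small for the state to exist, the left side is zero by convention and
  every coefficient on the right vanishes.\<close>

lemma state_severi_rec:
  assumes \<alpha>0: "lookup \<alpha> 0 = 0" and \<nu>: "normal_seq \<nu>"
    and j: "j > 0" "\<delta> + excess \<alpha> \<nu> \<le> j"
  shows "state_severi \<delta> \<alpha> \<nu> j = (\<Sum>(a, \<rho>, \<alpha>', \<nu>')\<in>transitions \<delta>.
    transition_coeff \<alpha> \<nu> (a, \<rho>, \<alpha>', \<nu>') j * state_severi (\<delta> - cost (a, \<rho>, \<alpha>', \<nu>')) \<alpha>' \<nu>' (j - 1))"
proof -
  have size: "seq_size \<nu> \<le> seq_weight \<nu>"
    using seq_size_le_weight \<nu> by (simp add: normal_seq_def)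
  have coeff_0: "transition_coeff \<alpha> \<nu> (a, \<rho>, \<alpha>', \<nu>') j = 0"
    if "(a, \<rho>, \<alpha>', \<nu>') \<in> transitions \<delta>" "j < seq_weight \<alpha> + seq_weight \<nu> + a" for a \<rho> \<alpha>' \<nu>'
  proof (cases "seq_le \<rho> \<nu>")
    case True
    show ?thesis using that by (intro transition_coeff_eq_0[OF True j(2) _ size]) (auto simp: transitions_def)
  qed simp
  show ?thesis
  proof (cases "seq_weight \<alpha> + seq_weight \<nu> \<le> j")
    case False
    then have "state_severi \<delta> \<alpha> \<nu> j = 0" by (simp add: state_severi_def)
    moreover have "transition_coeff \<alpha> \<nu> (a, \<rho>, \<alpha>', \<nu>') j = 0" if "(a, \<rho>, \<alpha>', \<nu>') \<in> transitions \<delta>" for a \<rho> \<alpha>' \<nu>'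
      using False by (intro coeff_0[OF that]) simp
    ultimately show ?thesis by (simp add: sum.neutral split_def)
  next
    case True
    define m where "m = j - seq_weight \<alpha> - seq_weight \<nu>"
    define \<beta> where "\<beta> = single 1 m + \<nu>"
    have jm: "j = seq_weight \<alpha> + seq_weight \<nu> + m" using True by (simp add: m_def)
    have \<nu>1: "lookup \<nu> 0 = 0" "lookup \<nu> 1 = 0" using \<nu> by (auto simp: normal_seq_def)
    have \<beta>0: "lookup \<beta> 0 = 0" and \<beta>1: "lookup \<beta> 1 = m" and \<beta>d: "drop1 \<beta> = \<nu>"
      using \<nu>1 drop1_normal[OF \<nu>] by (simp_all add: \<beta>_def lookup_add lookup_single when_def drop1_add)
    have \<beta>w: "seq_weight \<alpha> + seq_weight \<beta> = j" using jm by (simp add: \<beta>_def seq_weight_add)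
    define g where "g s \<alpha>' \<beta>' = const (multinomial s) * quantum_power s *
        (quantum_power (\<beta>' - (\<beta> - s)) * of_nat (seq_binomial (\<alpha> + s) \<alpha>') * of_nat (seq_binomial \<beta>' (\<beta> - s)) *
         rel_severi (j - 1) (int \<delta> - (int j - 1) + int (seq_size (\<beta>' - (\<beta> - s)))) \<alpha>' \<beta>')" for s \<alpha>' \<beta>'
    define U where "U = (SIGMA s:{s. seq_le s \<beta>}. floor_index j (\<alpha> + s) (\<beta> - s))"
    \<comment> \<open>Terms whose new \<delta> is negative vanish; on the others the cost is at most
      \<delta>.\<close>
    define U' where "U' = {(s, \<alpha>', \<beta>')\<in>U. 0 \<le> int \<delta> - (int j - 1) + int (seq_size (\<beta>' - (\<beta> - s)))}"
    define m' where "m' \<alpha>' \<nu>' = j - 1 - seq_weight \<alpha>' - seq_weight \<nu>'" for \<alpha>' \<nu>'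
    \<comment> \<open>The marked edges: the complement of \<open>single 1 a + \<rho>\<close> in
      \<open>\<beta>\<close>.\<close>
    define sx where "sx a \<rho> = single 1 (m - a) + (\<nu> - \<rho>)" for a \<rho>
    \<comment> \<open>The transitions that can actually occur from this state; they correspond
      bijectively to \<open>U'\<close>.\<close>
    define T' where "T' = {(a, \<rho>, \<alpha>', \<nu>')\<in>transitions \<delta>. a \<le> m \<and> seq_le \<rho> \<nu> \<and>
      seq_weight \<alpha>' + seq_weight \<nu>' \<le> j - 1 \<and> a \<le> m' \<alpha>' \<nu>' \<and> seq_le \<alpha>' (\<alpha> + sx a \<rho>)}"
    define h where "h = (\<lambda>(a, \<rho>, \<alpha>', \<nu>'). transition_coeff \<alpha> \<nu> (a, \<rho>, \<alpha>', \<nu>') j *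
      state_severi (\<delta> - cost (a, \<rho>, \<alpha>', \<nu>')) \<alpha>' \<nu>' (j - 1))"
    have diff1: "(single 1 x + p) - (single 1 y + q) = single 1 (x - y) + (p - q)"
      if "y \<le> x" "seq_le q p" for x y and p q :: sequence
      by (rule poly_mapping_eqI) (use that in \<open>auto simp: lookup_minus lookup_add lookup_single when_def seq_le_def\<close>)
    have \<beta>s: "\<beta> - sx a \<rho> = single 1 a + \<rho>" "seq_le (sx a \<rho>) \<beta>" if "a \<le> m" "seq_le \<rho> \<nu>" for a \<rho>
    proof -
      show "\<beta> - sx a \<rho> = single 1 a + \<rho>" unfolding \<beta>_def sx_def
        by (rule poly_mapping_eqI) (use that in \<open>auto simp: lookup_minus lookup_add lookup_single when_def seq_le_def intro: diff_diff_cancel add_mono\<close>)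
      show "seq_le (sx a \<rho>) \<beta>" unfolding \<beta>_def sx_def
        by (auto simp: lookup_minus lookup_add lookup_single when_def seq_le_def intro: add_mono)
    qed
    have coeff_eq: "transition_coeff \<alpha> \<nu> (a, \<rho>, \<alpha>', \<nu>') j = const (multinomial (sx a \<rho>)) * quantum_power (\<nu> - \<rho>) *
        quantum_power (\<nu>' - \<rho>) * of_nat (seq_binomial (\<alpha> + sx a \<rho>) \<alpha>') *
        of_nat ((m' \<alpha>' \<nu>' choose a) * seq_binomial \<nu>' \<rho>)"
      if a: "a \<le> m" and \<rho>: "seq_le \<rho> \<nu>" and w: "seq_weight \<alpha>' + seq_weight \<nu>' \<le> j - 1" for a \<rho> \<alpha>' \<nu>'
    proof -
      let ?n = "seq_size (\<nu> - \<rho>)"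
      have nd1: "lookup (\<nu> - \<rho>) 1 = 0" using \<nu>1 by (simp add: lookup_minus)
      have 1: "((of_nat j + (of_nat ?n - of_nat (seq_weight \<alpha> + seq_weight \<nu> + a)) :: rat) gchoose ?n)
          = of_nat ((m - a + ?n) choose ?n)"
        unfolding binomial_gbinomial using a jm by (simp add: of_nat_diff algebra_simps)
      have 2: "((of_nat j + (of_nat (lookup \<alpha> 1) - of_nat (seq_weight \<alpha> + seq_weight \<nu> + a)) :: rat) gchoose lookup \<alpha>' 1)
          = of_nat ((lookup \<alpha> 1 + (m - a)) choose lookup \<alpha>' 1)"
        unfolding binomial_gbinomial using a jm by (simp add: of_nat_diff algebra_simps)
      have "j = 1 + seq_weight \<alpha>' + seq_weight \<nu>' + m' \<alpha>' \<nu>'" using w j(1) by (simp add: m'_def)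
      then have "(of_nat j + (- of_nat (1 + seq_weight \<alpha>' + seq_weight \<nu>')) :: rat) = of_nat (m' \<alpha>' \<nu>')"
        by (metis add.commute add_diff_cancel_left' diff_conv_add_uminus of_nat_add)
      then have 3: "((of_nat j + (- of_nat (1 + seq_weight \<alpha>' + seq_weight \<nu>')) :: rat) gchoose a)
          = of_nat (m' \<alpha>' \<nu>' choose a)"
        by (simp only: binomial_gbinomial)
      have 4: "const (multinomial (sx a \<rho>)) = of_nat ((m - a + ?n) choose ?n) * const (multinomial (\<nu> - \<rho>))"
        unfolding sx_def multinomial_single_1_add[OF nd1] const_mult const_of_nat ..
      have 5: "seq_binomial (\<alpha> + sx a \<rho>) \<alpha>' = ((lookup \<alpha> 1 + (m - a)) choose lookup \<alpha>' 1) *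
          seq_binomial (drop1 \<alpha> + (\<nu> - \<rho>)) (drop1 \<alpha>')"
        unfolding seq_binomial_drop1[of "\<alpha> + sx a \<rho>"] using nd1 drop1_ident[OF nd1]
        by (simp add: sx_def lookup_add drop1_add)
      show ?thesis unfolding transition_coeff.simps 1 2 3 4 5 const_of_nat using \<rho>
        by (simp only: if_True of_nat_mult mult_ac)
    qed
    have fin_U: "finite U" unfolding U_def by (auto intro: finite_seq_le finite_floor_index)
    have "state_severi \<delta> \<alpha> \<nu> j = rel_severi j (int \<delta>) \<alpha> \<beta>"
      using True by (simp add: state_severi_def \<beta>_def m_def)
    also have "\<dots> = (\<Sum>s | seq_le s \<beta>. \<Sum>(\<alpha>', \<beta>')\<in>floor_index j (\<alpha> + s) (\<beta> - s). g s \<alpha>' \<beta>')"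
      unfolding rel_severi_batch[OF j(1) of_nat_0_le_iff \<beta>w \<alpha>0 \<beta>0] floor_sum_def
      by (simp add: g_def sum_distrib_left split_def)
    also have "\<dots> = (\<Sum>(s, \<alpha>', \<beta>')\<in>U. g s \<alpha>' \<beta>')"
      unfolding U_def by (rule sum.Sigma) (auto intro: finite_seq_le finite_floor_index)
    also have "\<dots> = (\<Sum>(s, \<alpha>', \<beta>')\<in>U'. g s \<alpha>' \<beta>')"
    proof (rule sum.mono_neutral_right[OF fin_U])
      show "\<forall>i\<in>U - U'. (case i of (s, \<alpha>', \<beta>') \<Rightarrow> g s \<alpha>' \<beta>') = 0"
      proof safe
        fix s \<alpha>' \<beta>' assume "(s, \<alpha>', \<beta>') \<in> U" "(s, \<alpha>', \<beta>') \<notin> U'"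
        then have "int \<delta> - (int j - 1) + int (seq_size (\<beta>' - (\<beta> - s))) < 0"
          by (auto simp: U'_def)
        then show "g s \<alpha>' \<beta>' = 0" by (simp only: g_def rel_severi_neg) simp
      qed
    qed (auto simp: U'_def)
    also have "\<dots> = (\<Sum>\<tau>\<in>T'. h \<tau>)"
    proof (rule sym, rule sum.reindex_bij_witness[of _
          "\<lambda>(s, \<alpha>', \<beta>'). (lookup (\<beta> - s) 1, drop1 (\<beta> - s), \<alpha>', drop1 \<beta>')"
          "\<lambda>(a, \<rho>, \<alpha>', \<nu>'). (sx a \<rho>, \<alpha>', single 1 (m' \<alpha>' \<nu>') + \<nu>')"])
      fix x assume x: "x \<in> U'"
      obtain s \<alpha>' \<beta>' where xe: "x = (s, \<alpha>', \<beta>')" by (cases x)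
      let ?a = "lookup (\<beta> - s) 1" and ?\<rho> = "drop1 (\<beta> - s)" and ?\<nu>' = "drop1 \<beta>'"
      have s: "seq_le s \<beta>" and \<alpha>': "seq_le \<alpha>' (\<alpha> + s)" and \<beta>': "seq_le (\<beta> - s) \<beta>'" "lookup \<beta>' 0 = 0"
        and w: "seq_weight \<alpha>' + seq_weight \<beta>' = j - 1"
        and pos: "0 \<le> int \<delta> - (int j - 1) + int (seq_size (\<beta>' - (\<beta> - s)))"
        using x unfolding xe U'_def U_def floor_index_def by auto
      have r: "single 1 ?a + ?\<rho> = \<beta> - s" by (rule drop1_eq)
      have b: "single 1 (lookup \<beta>' 1) + ?\<nu>' = \<beta>'" by (rule drop1_eq)
      have a: "?a \<le> m" using \<beta>1 by (simp add: lookup_minus)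
      have \<rho>: "seq_le ?\<rho> \<nu>" unfolding \<beta>d[symmetric] seq_le_def by (simp add: lookup_drop1 lookup_minus)
      have \<rho>': "seq_le ?\<rho> ?\<nu>'" using \<beta>'(1) by (simp add: seq_le_def lookup_drop1)
      have s_eq: "sx ?a ?\<rho> = s"
      proof -
        have "sx ?a ?\<rho> = \<beta> - (single 1 ?a + ?\<rho>)"
          unfolding sx_def \<beta>_def by (rule diff1[symmetric]) (use a \<rho> in \<open>auto simp: \<beta>_def\<close>)
        also have "\<dots> = s" unfolding r
          by (rule poly_mapping_eqI) (use s in \<open>auto simp: seq_le_def lookup_minus\<close>)
        finally show ?thesis .
      qed
      have wb: "seq_weight \<beta>' = lookup \<beta>' 1 + seq_weight ?\<nu>'"
        using seq_weight_add[of "single 1 (lookup \<beta>' 1)" ?\<nu>'] unfolding b by simp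
      have m'_eq: "m' \<alpha>' ?\<nu>' = lookup \<beta>' 1" using w wb by (simp add: m'_def)
      show "(case case x of (s, \<alpha>', \<beta>') \<Rightarrow> (lookup (\<beta> - s) 1, drop1 (\<beta> - s), \<alpha>', drop1 \<beta>') of
          (a, \<rho>, \<alpha>', \<nu>') \<Rightarrow> (sx a \<rho>, \<alpha>', single 1 (m' \<alpha>' \<nu>') + \<nu>')) = x"
        unfolding xe by (simp add: s_eq m'_eq b del: One_nat_def)
      have a': "?a \<le> m' \<alpha>' ?\<nu>'" unfolding m'_eq using \<beta>'(1) by (simp add: seq_le_def)
      have "lookup s 0 = 0" using s \<beta>0 by (metis le_zero_eq seq_le_def)
      then have \<alpha>'0: "lookup \<alpha>' 0 = 0" using \<alpha>' \<alpha>0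
        by (metis add.right_neutral le_zero_eq lookup_add seq_le_def)
      have \<nu>': "normal_seq ?\<nu>'" using \<beta>'(2) by (simp add: normal_seq_def lookup_drop1)
      have sz: "seq_size \<beta>' = lookup \<beta>' 1 + seq_size ?\<nu>'" "seq_size (\<beta> - s) = ?a + seq_size ?\<rho>"
        using seq_size_add[of "single 1 (lookup \<beta>' 1)" ?\<nu>'] seq_size_add[of "single 1 ?a" ?\<rho>]
        unfolding b r by simp_all
      have "int (seq_size (\<beta>' - (\<beta> - s))) = int (seq_size \<beta>') - int (seq_size (\<beta> - s))"
        using seq_size_diff[OF \<beta>'(1)] seq_size_mono[OF \<beta>'(1)] by simp
      moreover have "seq_size ?\<nu>' \<le> seq_weight ?\<nu>'" using seq_size_le_weight \<nu>' by (simp add: normal_seq_def)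
      \<comment> \<open>The cost is j - 1 minus the number of new edges, so the floor replaces
        \<delta> by \<delta> minus the cost.\<close>
      ultimately have ce: "int (cost (?a, ?\<rho>, \<alpha>', ?\<nu>')) =
           (int j - 1) - int (seq_size (\<beta>' - (\<beta> - s)))"
        using w wb sz j(1) by (simp add: excess_def)
      then have "cost (?a, ?\<rho>, \<alpha>', ?\<nu>') \<le> \<delta>" using pos by linarith
      then show "(case x of (s, \<alpha>', \<beta>') \<Rightarrow> (lookup (\<beta> - s) 1, drop1 (\<beta> - s), \<alpha>', drop1 \<beta>')) \<in> T'"
        unfolding xe T'_def transitions_def using a \<rho> \<rho>' a' \<alpha>'0 \<nu>' \<alpha>' w wb s_eq by auto
    next
      fix \<tau> assume \<tau>: "\<tau> \<in> T'"
      obtain a \<rho> \<alpha>' \<nu>' where te: "\<tau> = (a, \<rho>, \<alpha>', \<nu>')" by (cases \<tau>)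
      let ?\<beta>' = "single 1 (m' \<alpha>' \<nu>') + \<nu>'"
      have \<alpha>'0: "lookup \<alpha>' 0 = 0" and \<nu>': "normal_seq \<nu>'" and \<rho>': "seq_le \<rho> \<nu>'" and c: "cost (a, \<rho>, \<alpha>', \<nu>') \<le> \<delta>"
        and a: "a \<le> m" and \<rho>: "seq_le \<rho> \<nu>" and w: "seq_weight \<alpha>' + seq_weight \<nu>' \<le> j - 1"
        and a': "a \<le> m' \<alpha>' \<nu>'" and \<alpha>': "seq_le \<alpha>' (\<alpha> + sx a \<rho>)"
        using \<tau> unfolding te T'_def transitions_def by auto
      have \<rho>n: "normal_seq \<rho>" by (rule normal_seq_le[OF \<rho> \<nu>])
      have \<rho>1: "lookup \<rho> 1 = 0" and \<nu>'1: "lookup \<nu>' 1 = 0" "lookup \<nu>' 0 = 0"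
        using \<rho>n \<nu>' by (auto simp: normal_seq_def)
      note bs = \<beta>s[OF a \<rho>]
      have jw: "j - 1 = m' \<alpha>' \<nu>' + seq_weight \<alpha>' + seq_weight \<nu>'" using w by (simp add: m'_def)
      show "(case case \<tau> of (a, \<rho>, \<alpha>', \<nu>') \<Rightarrow> (sx a \<rho>, \<alpha>', single 1 (m' \<alpha>' \<nu>') + \<nu>') of
          (s, \<alpha>', \<beta>') \<Rightarrow> (lookup (\<beta> - s) 1, drop1 (\<beta> - s), \<alpha>', drop1 \<beta>')) = \<tau>"
        unfolding te using \<rho>1 \<nu>'1 drop1_normal[OF \<rho>n] drop1_normal[OF \<nu>']
        by (simp add: bs(1) lookup_add drop1_add)
      have le: "seq_le (single 1 a + \<rho>) ?\<beta>'"
        using a' \<rho>' by (auto simp: seq_le_def lookup_add lookup_single when_def intro: add_mono)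
      have d: "?\<beta>' - (\<beta> - sx a \<rho>) = single 1 (m' \<alpha>' \<nu>' - a) + (\<nu>' - \<rho>)"
        unfolding bs(1) by (rule diff1[OF a' \<rho>'])
      have "int (seq_size (?\<beta>' - (\<beta> - sx a \<rho>))) = int (m' \<alpha>' \<nu>') - int a + (int (seq_size \<nu>') - int (seq_size \<rho>))"
        unfolding d using a' seq_size_diff[OF \<rho>'] seq_size_mono[OF \<rho>'] by (simp add: seq_size_add)
      moreover have "seq_size \<nu>' \<le> seq_weight \<nu>'" using seq_size_le_weight \<nu>'1 by blast
      ultimately have de: "int \<delta> - (int j - 1) + int (seq_size (?\<beta>' - (\<beta> - sx a \<rho>))) = int (\<delta> - cost (a, \<rho>, \<alpha>', \<nu>'))"
        using jw c j(1) by (simp add: excess_def)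
      have "(sx a \<rho>, \<alpha>', ?\<beta>') \<in> U"
        unfolding U_def floor_index_def using bs \<alpha>' le jw \<nu>'1
        by (auto simp: lookup_add lookup_single when_def seq_weight_add)
      then show "(case \<tau> of (a, \<rho>, \<alpha>', \<nu>') \<Rightarrow> (sx a \<rho>, \<alpha>', single 1 (m' \<alpha>' \<nu>') + \<nu>')) \<in> U'"
        unfolding te U'_def using de by simp
      have sb: "seq_binomial ?\<beta>' (single 1 a + \<rho>) = (m' \<alpha>' \<nu>' choose a) * seq_binomial \<nu>' \<rho>"
        unfolding seq_binomial_drop1[of ?\<beta>'] using \<rho>1 \<nu>'1 drop1_normal[OF \<rho>n] drop1_normal[OF \<nu>']
        by (simp add: lookup_add drop1_add)
      have F: "state_severi (\<delta> - cost (a, \<rho>, \<alpha>', \<nu>')) \<alpha>' \<nu>' (j - 1) =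
          rel_severi (j - 1) (int (\<delta> - cost (a, \<rho>, \<alpha>', \<nu>'))) \<alpha>' ?\<beta>'"
        using w by (simp add: state_severi_def m'_def)
      have q: "quantum_power (single 1 x + p) = quantum_power p" for x p
        by (simp only: quantum_power_add quantum_power_single1 mult_1)
      have "g (sx a \<rho>) \<alpha>' ?\<beta>' = h \<tau>"
        unfolding te h_def prod.case coeff_eq[OF a \<rho> w] F g_def de
        unfolding bs(1) diff1[OF a' \<rho>'] sb unfolding sx_def q by (simp only: mult_ac)
      then show "(case case \<tau> of (a, \<rho>, \<alpha>', \<nu>') \<Rightarrow> (sx a \<rho>, \<alpha>', single 1 (m' \<alpha>' \<nu>') + \<nu>') of
          (s, \<alpha>', \<beta>') \<Rightarrow> g s \<alpha>' \<beta>') = h \<tau>"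
        unfolding te prod.case .
    qed
    also have "\<dots> = (\<Sum>\<tau>\<in>transitions \<delta>. h \<tau>)"
    proof (rule sum.mono_neutral_left[OF finite_transitions])
      show "\<forall>\<tau>\<in>transitions \<delta> - T'. h \<tau> = 0"
      proof
        fix \<tau> assume \<tau>: "\<tau> \<in> transitions \<delta> - T'"
        obtain a \<rho> \<alpha>' \<nu>' where te: "\<tau> = (a, \<rho>, \<alpha>', \<nu>')" by (cases \<tau>)
        have tr: "(a, \<rho>, \<alpha>', \<nu>') \<in> transitions \<delta>" using \<tau> te by simp
        \<comment> \<open>An impossible transition contributes zero: its coefficient vanishes by
          definition or by \<open>coeff_0\<close>, its target has too large a weight, or an ordinary
          binomial factor is zero.\<close>
        consider "\<not> seq_le \<rho> \<nu>" | "\<not> a \<le> m" | "\<not> seq_weight \<alpha>' + seq_weight \<nu>' \<le> j - 1"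
          | "a \<le> m" "seq_le \<rho> \<nu>" "seq_weight \<alpha>' + seq_weight \<nu>' \<le> j - 1"
            "\<not> a \<le> m' \<alpha>' \<nu>' \<or> \<not> seq_le \<alpha>' (\<alpha> + sx a \<rho>)"
          using \<tau> unfolding te T'_def by blast
        then show "h \<tau> = 0"
        proof cases
          case 1
          then show ?thesis by (simp add: h_def te)
        next
          case 2
          then show ?thesis using coeff_0[OF tr] jm by (simp add: h_def te del: transition_coeff.simps)
        next
          case 3
          then show ?thesis by (simp add: h_def te state_severi_def)
        next
          case 4
          then have "(m' \<alpha>' \<nu>' choose a) = 0 \<or> seq_binomial (\<alpha> + sx a \<rho>) \<alpha>' = 0"
            by (metis binomial_eq_0 not_le seq_binomial_eq_0)
          then show ?thesis unfolding h_def te prod.case coeff_eq[OF 4(1-3)] by auto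
        qed
      qed
    qed (auto simp: T'_def)
    finally show ?thesis by (simp add: h_def)
  qed
qed

section \<open>Polynomiality\<close>

abbreviation "qtwo \<equiv> rat_laurent (quantum_int 2)"

text \<open>In closed form this is (y + 4 + 1/y)^\<delta> / (2^\<delta> \<delta>!).\<close>

primrec top_coeff :: "nat \<Rightarrow> rat half_laurent" where
  "top_coeff 0 = 1"
| "top_coeff (Suc \<delta>) = const (1 / of_nat (2 * Suc \<delta>)) * ((2 + qtwo ^ 2) * top_coeff \<delta>)"

lemma poly_from_transition_coeff:
  assumes "seq_le \<rho> \<nu>"
  shows "poly_from n (seq_size (\<nu> - \<rho>) + lookup \<alpha>' 1 + a)
    (const (multinomial (\<nu> - \<rho>)) * quantum_power (\<nu> - \<rho>) * quantum_power (\<nu>' - \<rho>) *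
      of_nat (seq_binomial (drop1 \<alpha> + (\<nu> - \<rho>)) (drop1 \<alpha>')) * of_nat (seq_binomial \<nu>' \<rho>) *
      const (1 / fact (seq_size (\<nu> - \<rho>))) * const (1 / fact (lookup \<alpha>' 1)) * const (1 / fact a))
    (transition_coeff \<alpha> \<nu> (a, \<rho>, \<alpha>', \<nu>'))"
proof -
  have *: "transition_coeff \<alpha> \<nu> (a, \<rho>, \<alpha>', \<nu>') = (\<lambda>j.
     (const (multinomial (\<nu> - \<rho>)) * quantum_power (\<nu> - \<rho>) * quantum_power (\<nu>' - \<rho>) *
      of_nat (seq_binomial (drop1 \<alpha> + (\<nu> - \<rho>)) (drop1 \<alpha>')) * of_nat (seq_binomial \<nu>' \<rho>)) *
     const ((of_nat j + (of_nat (seq_size (\<nu> - \<rho>)) - of_nat (seq_weight \<alpha> + seq_weight \<nu> + a)))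
       gchoose seq_size (\<nu> - \<rho>)) *
     const ((of_nat j + (of_nat (lookup \<alpha> 1) - of_nat (seq_weight \<alpha> + seq_weight \<nu> + a))) gchoose lookup \<alpha>' 1) *
     const ((of_nat j + (- of_nat (1 + seq_weight \<alpha>' + seq_weight \<nu>'))) gchoose a))"
    by (rule ext) (simp only: transition_coeff.simps assms if_True)
  show ?thesis unfolding *
    by (intro poly_from_mult poly_from_cmult poly_from_gbinomial)
qed

lemma excess_eq_0:
  assumes "lookup \<alpha> 0 = 0" "normal_seq \<nu>" "excess \<alpha> \<nu> = 0"
  shows "\<alpha> = 0" "\<nu> = 0"
proof -
  show "\<alpha> = 0" using assms seq_weight_eq_0 by (simp add: excess_def)
  have "seq_size \<nu> = 0" using normal_seq_weight[OF assms(2)] assms(3) unfolding excess_def by linarith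
  then show "\<nu> = 0" by simp
qed

lemma normal_seq_excess_1:
  assumes "normal_seq \<nu>" "seq_weight \<nu> - seq_size \<nu> = 1"
  shows "\<nu> = single 2 1"
proof -
  have 2: "2 * seq_size \<nu> \<le> seq_weight \<nu>" by (rule normal_seq_weight[OF assms(1)])
  have "\<nu> \<noteq> 0" using assms(2) by auto
  then obtain k q where k: "k \<in> keys \<nu>" "\<nu> = q + single k (1::nat)" by (rule seq_remove)
  have sz: "seq_size \<nu> = seq_size q + 1" "seq_weight \<nu> = seq_weight q + k"
    by (simp_all add: k(2) seq_size_add seq_weight_add)
  have "k \<noteq> 0" "k \<noteq> 1" using k(1) assms(1) by (auto simp: normal_seq_def in_keys_iff intro: ccontr)
  have "seq_size q = 0" "k = 2" using sz 2 assms(2) \<open>k \<noteq> 0\<close> \<open>k \<noteq> 1\<close> by linarith+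
  then show ?thesis using k by simp
qed

lemma cost_eq_0:
  assumes "(a, \<rho>, \<alpha>, \<nu>) \<in> transitions \<delta>" "cost (a, \<rho>, \<alpha>, \<nu>) = 0"
  shows "(a, \<rho>, \<alpha>, \<nu>) = (0, 0, 0, 0)"
  using assms excess_eq_0[of \<alpha> \<nu>] by (auto simp: transitions_def)

text \<open>The three sources of \<open>2 + qtwo ^ 2\<close>: an unmarked edge of weight one crosses
  the floor, a marked one does, or a new edge of weight two appears.\<close>

lemma cost_eq_1:
  assumes "(a, 0, \<alpha>, \<nu>) \<in> transitions \<delta>" "cost (a, 0, \<alpha>, \<nu>) = 1"
  shows "(a, \<alpha>, \<nu>) \<in> {(1, 0, 0), (0, single 1 1, 0), (0, 0, single 2 1)}"
proof -
  have 0: "lookup \<alpha> 0 = 0" "normal_seq \<nu>" using assms by (auto simp: transitions_def)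
  have "seq_weight \<alpha> + (seq_weight \<nu> - seq_size \<nu>) + a = 1" using assms(2) by (simp add: excess_def)
  then consider "a = 1" "seq_weight \<alpha> + (seq_weight \<nu> - seq_size \<nu>) = 0"
    | "a = 0" "seq_weight \<alpha> = 1" "seq_weight \<nu> - seq_size \<nu> = 0"
    | "a = 0" "seq_weight \<alpha> = 0" "seq_weight \<nu> - seq_size \<nu> = 1" by linarith
  then show ?thesis
  proof cases
    case 1
    then show ?thesis using excess_eq_0[OF 0] by (simp add: excess_def)
  next
    case 2
    then show ?thesis using excess_eq_0[of 0 \<nu>] 0 seq_weight_eq_1[of \<alpha>] by (simp add: excess_def)
  next
    case 3
    then show ?thesis using seq_weight_eq_0[of \<alpha>] normal_seq_excess_1 0 by simp
  qed
qed

lemma lookup_1_le_weight: "lookup \<alpha> 1 \<le> seq_weight \<alpha>"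
  by (rule lookup_le_seq_weight) simp

text \<open>Marking the edges of \<nu> among many edges of weight one contributes j^|\<nu>| over the
  product of the \<nu>_i! to leading order. The marked edges \<alpha> do not affect the leading
  term.\<close>

definition state_top :: "nat \<Rightarrow> sequence \<Rightarrow> rat half_laurent" where
  "state_top \<delta> \<nu> = const (1 / seq_fact \<nu>) * quantum_power \<nu> * top_coeff \<delta>"

abbreviation polynomial_state :: "nat \<Rightarrow> sequence \<Rightarrow> sequence \<Rightarrow> bool" where
  "polynomial_state \<delta> \<alpha> \<nu> \<equiv>
     poly_from (\<delta> + excess \<alpha> \<nu>) (2 * \<delta> + seq_size \<nu>) (state_top \<delta> \<nu>) (state_severi \<delta> \<alpha> \<nu>)"

text \<open>A unit of cost loses two degrees through \<delta> and regains at most one through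
  \<alpha>'_1, a and |\<nu>'|. Hence only the cost-free transition can reach the top degree.\<close>

lemma transition_degree:
  assumes "(a, \<rho>, \<alpha>', \<nu>') \<in> transitions \<delta>" "seq_le \<rho> \<nu>"
  shows "seq_size (\<nu> - \<rho>) + lookup \<alpha>' 1 + a + (2 * (\<delta> - cost (a, \<rho>, \<alpha>', \<nu>')) + seq_size \<nu>')
     + cost (a, \<rho>, \<alpha>', \<nu>') \<le> 2 * \<delta> + seq_size \<nu>"
proof -
  have c: "cost (a, \<rho>, \<alpha>', \<nu>') \<le> \<delta>" and "normal_seq \<nu>'" using assms(1) by (auto simp: transitions_def)
  have "seq_size \<nu>' \<le> seq_weight \<nu>' - seq_size \<nu>'"
    using normal_seq_weight[OF \<open>normal_seq \<nu>'\<close>] by simp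
  then have "lookup \<alpha>' 1 + a + seq_size \<nu>' \<le> cost (a, \<rho>, \<alpha>', \<nu>')"
    using lookup_1_le_weight[of \<alpha>'] by (simp add: excess_def)
  then show ?thesis using c seq_size_diff[OF assms(2)] by linarith
qed

text \<open>The cost includes the excess of the target, so the threshold there is at most \<delta>;
  the shift to \<open>j - 1\<close> makes it \<open>Suc \<delta>\<close>.\<close>

lemma poly_from_transition:
  assumes \<tau>: "(a, \<rho>, \<alpha>', \<nu>') \<in> transitions \<delta>" and \<rho>: "seq_le \<rho> \<nu>"
    and IH: "polynomial_state (\<delta> - cost (a, \<rho>, \<alpha>', \<nu>')) \<alpha>' \<nu>'"
  shows "poly_from (Suc \<delta>) (seq_size (\<nu> - \<rho>) + lookup \<alpha>' 1 + a +
      (2 * (\<delta> - cost (a, \<rho>, \<alpha>', \<nu>')) + seq_size \<nu>'))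
    (const (multinomial (\<nu> - \<rho>)) * quantum_power (\<nu> - \<rho>) * quantum_power (\<nu>' - \<rho>) *
      of_nat (seq_binomial (drop1 \<alpha> + (\<nu> - \<rho>)) (drop1 \<alpha>')) * of_nat (seq_binomial \<nu>' \<rho>) *
      const (1 / fact (seq_size (\<nu> - \<rho>))) * const (1 / fact (lookup \<alpha>' 1)) * const (1 / fact a) *
      state_top (\<delta> - cost (a, \<rho>, \<alpha>', \<nu>')) \<nu>')
    (\<lambda>j. transition_coeff \<alpha> \<nu> (a, \<rho>, \<alpha>', \<nu>') j * state_severi (\<delta> - cost (a, \<rho>, \<alpha>', \<nu>')) \<alpha>' \<nu>' (j - 1))"
proof (rule poly_from_mult[OF poly_from_transition_coeff[OF \<rho>]])
  have "excess \<alpha>' \<nu>' \<le> cost (a, \<rho>, \<alpha>', \<nu>')" by simp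
  moreover have "cost (a, \<rho>, \<alpha>', \<nu>') \<le> \<delta>" using \<tau> by (simp add: transitions_def)
  ultimately have "\<delta> - cost (a, \<rho>, \<alpha>', \<nu>') + excess \<alpha>' \<nu>' \<le> \<delta>" by linarith
  then show "poly_from (Suc \<delta>) (2 * (\<delta> - cost (a, \<rho>, \<alpha>', \<nu>')) + seq_size \<nu>')
      (state_top (\<delta> - cost (a, \<rho>, \<alpha>', \<nu>')) \<nu>')
      (\<lambda>j. state_severi (\<delta> - cost (a, \<rho>, \<alpha>', \<nu>')) \<alpha>' \<nu>' (j - 1))"
    by (intro poly_from_mono[OF poly_from_shift[OF IH]]) simp
qed

lemma poly_from_transition_top_0:
  assumes \<tau>: "(a, \<rho>, \<alpha>', \<nu>') \<in> transitions \<delta>"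
    and IH: "polynomial_state (\<delta> - cost (a, \<rho>, \<alpha>', \<nu>')) \<alpha>' \<nu>'"
    and D: "2 * \<delta> + seq_size \<nu> < D + cost (a, \<rho>, \<alpha>', \<nu>')"
  shows "poly_from (Suc \<delta>) D 0
    (\<lambda>j. transition_coeff \<alpha> \<nu> (a, \<rho>, \<alpha>', \<nu>') j * state_severi (\<delta> - cost (a, \<rho>, \<alpha>', \<nu>')) \<alpha>' \<nu>' (j - 1))"
proof (cases "seq_le \<rho> \<nu>")
  case True
  show ?thesis using transition_degree[OF \<tau> True] D
    by (intro poly_from_less_degree[OF poly_from_transition[OF \<tau> True IH]]) linarith
next
  case False
  then show ?thesis using poly_from_zero by simp
qed

lemma zero_transition: "(0, 0, 0, 0) \<in> transitions \<delta>"
  by (simp add: transitions_def excess_def)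

text \<open>The cost-free transition has coefficient one and returns the same function at
  \<open>j - 1\<close>. All other transitions lower \<delta>, and those of cost one give the
  coefficient at degree 2 \<delta> - 1.\<close>

lemma state_severi_0_difference:
  assumes \<delta>: "\<delta> > 0" and IH: "\<And>\<delta>' \<alpha> \<nu>. \<delta>' < \<delta> \<Longrightarrow> lookup \<alpha> 0 = 0 \<Longrightarrow> normal_seq \<nu> \<Longrightarrow> polynomial_state \<delta>' \<alpha> \<nu>"
  shows "poly_from (Suc \<delta>) (2 * \<delta> - 1) ((2 + qtwo ^ 2) * top_coeff (\<delta> - 1))
    (\<lambda>j. state_severi \<delta> 0 0 j - state_severi \<delta> 0 0 (j - 1))"
proof -
  let ?z = "(0, 0, 0, 0) :: nat \<times> sequence \<times> sequence \<times> sequence"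
  let ?t1 = "(1, 0, 0, 0) :: nat \<times> sequence \<times> sequence \<times> sequence"
  let ?t2 = "(0, 0, single 1 1, 0) :: nat \<times> sequence \<times> sequence \<times> sequence"
  let ?t3 = "(0, 0, 0, single 2 1) :: nat \<times> sequence \<times> sequence \<times> sequence"
  define h where "h \<tau> j = (case \<tau> of (a, \<rho>, \<alpha>', \<nu>') \<Rightarrow>
    transition_coeff 0 0 (a, \<rho>, \<alpha>', \<nu>') j * state_severi (\<delta> - cost (a, \<rho>, \<alpha>', \<nu>')) \<alpha>' \<nu>' (j - 1))" for \<tau> j
  define L where "L \<tau> = (if \<tau> = ?t1 \<or> \<tau> = ?t2 then top_coeff (\<delta> - 1) else if \<tau> = ?t3
    then qtwo ^ 2 * top_coeff (\<delta> - 1) else 0)" for \<tau>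
  have "poly_from (Suc \<delta>) (2 * \<delta> - 1) (L \<tau>) (h \<tau>)" if \<tau>: "\<tau> \<in> transitions \<delta> - {?z}" for \<tau>
  proof -
    obtain a \<rho> \<alpha>' \<nu>' where te: "\<tau> = (a, \<rho>, \<alpha>', \<nu>')" by (cases \<tau>)
    have tr: "(a, \<rho>, \<alpha>', \<nu>') \<in> transitions \<delta>" and nz: "(a, \<rho>, \<alpha>', \<nu>') \<noteq> ?z" using \<tau> te by auto
    have c: "cost (a, \<rho>, \<alpha>', \<nu>') \<ge> 1" using cost_eq_0[OF tr] nz by linarith
    have IH': "polynomial_state (\<delta> - cost (a, \<rho>, \<alpha>', \<nu>')) \<alpha>' \<nu>'"
      using tr c \<delta> by (intro IH) (auto simp: transitions_def)
    have h: "h \<tau> = (\<lambda>j. transition_coeff 0 0 (a, \<rho>, \<alpha>', \<nu>') j *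
        state_severi (\<delta> - cost (a, \<rho>, \<alpha>', \<nu>')) \<alpha>' \<nu>' (j - 1))"
      by (rule ext) (simp only: h_def te prod.case)
    consider "cost (a, \<rho>, \<alpha>', \<nu>') \<ge> 2" | "\<rho> \<noteq> 0" | "\<rho> = 0" "cost (a, \<rho>, \<alpha>', \<nu>') = 1" using c by linarith
    then show ?thesis
    proof cases
      case 1
      then have "L \<tau> = 0" by (auto simp: L_def te excess_def)
      then show ?thesis unfolding h
        using poly_from_transition_top_0[OF tr IH', of 0 "2 * \<delta> - 1" 0] 1 \<delta> by simp
    next
      case 2
      then have "\<not> seq_le \<rho> 0" by (metis le_zero_eq lookup_zero poly_mapping_eqI seq_le_def)
      then have "h \<tau> = (\<lambda>_. 0)" unfolding h by (simp add: fun_eq_iff)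
      moreover have "L \<tau> = 0" using 2 by (simp add: L_def te)
      ultimately show ?thesis using poly_from_zero by simp
    next
      case 3
      note P = poly_from_transition[OF tr[unfolded 3(1)], of 0 0, OF seq_le_refl IH'[unfolded 3(1)]]
      have c1: "cost (a, 0, \<alpha>', \<nu>') = 1" using 3 by simp
      have two: "2 * (\<delta> - 1) = 2 * \<delta> - 2" "Suc (2 * \<delta> - 2) = 2 * \<delta> - 1" using \<delta> by auto
      have "(a, \<alpha>', \<nu>') \<in> {(1, 0, 0), (0, single 1 1, 0), (0, 0, single 2 1)}"
        using cost_eq_1 tr 3 by blast
      then consider "a = 1" "\<alpha>' = 0" "\<nu>' = 0" | "a = 0" "\<alpha>' = single 1 1" "\<nu>' = 0"
        | "a = 0" "\<alpha>' = 0" "\<nu>' = single 2 1" by auto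
      then show ?thesis
      proof cases
        case 1
        then have "L \<tau> = top_coeff (\<delta> - 1)" using 3 by (simp add: L_def te)
        then show ?thesis unfolding h using P 3(1) 1 two c1
          by (simp add: state_top_def drop1_def del: transition_coeff.simps cost.simps)
      next
        case 2
        then have "L \<tau> = top_coeff (\<delta> - 1)" using 3 by (simp add: L_def te)
        then show ?thesis unfolding h using P 3(1) 2 two c1
          by (simp add: state_top_def drop1_def del: transition_coeff.simps cost.simps)
      next
        case 3
        have "single 2 1 \<noteq> (0 :: sequence)" by (metis lookup_single_eq lookup_zero zero_neq_one)
        \<comment> \<open>One factor \<open>qtwo\<close> comes from creating the edge of weight two,
          the other from \<open>state_top\<close>, where this edge is marked.\<close>
        then have "L \<tau> = qtwo * qtwo * top_coeff (\<delta> - 1)" using 3 \<open>\<rho> = 0\<close>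
          by (simp add: L_def te power2_eq_square)
        moreover have "seq_fact (single 2 1) = 1" by (simp add: seq_fact_def)
        ultimately show ?thesis unfolding h using P \<open>\<rho> = 0\<close> 3 two c1
          by (simp add: state_top_def drop1_def quantum_power_single mult.assoc
              del: transition_coeff.simps cost.simps)
      qed
    qed
  qed
  then have "poly_from (Suc \<delta>) (2 * \<delta> - 1) (\<Sum>\<tau>\<in>transitions \<delta> - {?z}. L \<tau>)
      (\<lambda>j. \<Sum>\<tau>\<in>transitions \<delta> - {?z}. h \<tau> j)"
    by (rule poly_from_sum)
  also have "(\<Sum>\<tau>\<in>transitions \<delta> - {?z}. L \<tau>) = (2 + qtwo ^ 2) * top_coeff (\<delta> - 1)"
  proof -
    have ne: "single (Suc 0) (Suc 0) \<noteq> (0 :: sequence)" "single 2 (Suc 0) \<noteq> (0 :: sequence)"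
      by (metis lookup_single_eq lookup_zero nat.distinct(1))+
    have "normal_seq (single 2 1)" by (simp add: normal_seq_def lookup_single)
    then have sub: "{?t1, ?t2, ?t3} \<subseteq> transitions \<delta> - {?z}"
      using \<delta> ne by (auto simp: transitions_def excess_def lookup_single)
    have "(\<Sum>\<tau>\<in>transitions \<delta> - {?z}. L \<tau>) = (\<Sum>\<tau>\<in>{?t1, ?t2, ?t3}. L \<tau>)"
      by (rule sum.mono_neutral_right[OF _ sub]) (auto simp: L_def finite_transitions)
    also have "\<dots> = (2 + qtwo ^ 2) * top_coeff (\<delta> - 1)"
      using ne by (simp add: L_def algebra_simps)
    finally show ?thesis .
  qed
  finally show ?thesis
  proof (rule poly_from_cong)
    fix j assume j: "Suc \<delta> \<le> j"
    have "state_severi \<delta> 0 0 j = (\<Sum>\<tau>\<in>transitions \<delta>. h \<tau> j)"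
      unfolding h_def using j by (subst state_severi_rec) (auto simp: excess_def)
    also have "\<dots> = h ?z j + (\<Sum>\<tau>\<in>transitions \<delta> - {?z}. h \<tau> j)"
      by (rule sum.remove[OF finite_transitions zero_transition])
    also have "h ?z j = state_severi \<delta> 0 0 (j - 1)"
      by (simp add: h_def excess_def drop1_def)
    finally show "state_severi \<delta> 0 0 j - state_severi \<delta> 0 0 (j - 1) = (\<Sum>\<tau>\<in>transitions \<delta> - {?z}. h \<tau> j)"
      by simp
  qed
qed

text \<open>At \<delta> = 0 only the cost-free transition remains, and the value \<open>1\<close> is
  inherited from the empty state of degree zero.\<close>

lemma state_severi_0_0: "state_severi 0 0 0 j = 1"
proof (induction j)
  case 0
  show ?case by (simp add: state_severi_def rel_severi_def)
next
  case (Suc j)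
  have "transitions 0 = {(0, 0, 0, 0)}"
    using cost_eq_0 zero_transition by (fastforce simp: transitions_def)
  then have "state_severi 0 0 0 (Suc j) = state_severi 0 0 0 j"
    by (subst state_severi_rec) (auto simp: excess_def drop1_def)
  then show ?case using Suc by simp
qed

text \<open>For each \<delta> the normal state comes first, by summing its difference equation. Any
  other state is then expressed by the normal state with the same \<delta> and by states with
  smaller \<delta>; its positive excess absorbs the shift of the threshold to
  \<open>Suc \<delta>\<close>.\<close>

lemma polynomial_state:
  "lookup \<alpha> 0 = 0 \<Longrightarrow> normal_seq \<nu> \<Longrightarrow> polynomial_state \<delta> \<alpha> \<nu>"
proof (induction \<delta> arbitrary: \<alpha> \<nu> rule: less_induct)
  case (less \<delta>)
  have zero: "polynomial_state \<delta> 0 0"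
  proof (cases "\<delta> = 0")
    case True
    then show ?thesis using poly_from_const[of 0 1]
      by (simp add: excess_def state_top_def state_severi_0_0[abs_def])
  next
    case False
    then obtain e where e: "\<delta> = Suc e" by (metis not0_implies_Suc)
    have "poly_from \<delta> (Suc (2 * \<delta> - 1)) (const (1 / of_nat (Suc (2 * \<delta> - 1))) *
        ((2 + qtwo ^ 2) * top_coeff (\<delta> - 1))) (state_severi \<delta> 0 0)"
      using False less.IH by (intro poly_from_antidifference state_severi_0_difference) auto
    moreover have "Suc (2 * \<delta> - 1) = 2 * \<delta>" using False by simp
    moreover have "const (1 / of_nat (2 * \<delta>)) * ((2 + qtwo ^ 2) * top_coeff (\<delta> - 1)) = top_coeff \<delta>"
      unfolding e by (simp only: top_coeff.simps diff_Suc_1)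
    ultimately show ?thesis by (simp add: excess_def state_top_def)
  qed
  show ?case
  proof (cases "excess \<alpha> \<nu> = 0")
    case True
    then show ?thesis using zero excess_eq_0[OF less.prems] by simp
  next
    case False
    let ?z = "(0, 0, 0, 0) :: nat \<times> sequence \<times> sequence \<times> sequence"
    let ?D = "2 * \<delta> + seq_size \<nu>"
    define h where "h \<tau> j = (case \<tau> of (a, \<rho>, \<alpha>', \<nu>') \<Rightarrow>
      transition_coeff \<alpha> \<nu> (a, \<rho>, \<alpha>', \<nu>') j * state_severi (\<delta> - cost (a, \<rho>, \<alpha>', \<nu>')) \<alpha>' \<nu>' (j - 1))" for \<tau> j
    have "poly_from (Suc \<delta>) ?D (if \<tau> = ?z then state_top \<delta> \<nu> else 0) (h \<tau>)" if \<tau>: "\<tau> \<in> transitions \<delta>" for \<tau>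
    proof -
      obtain a \<rho> \<alpha>' \<nu>' where te: "\<tau> = (a, \<rho>, \<alpha>', \<nu>')" by (cases \<tau>)
      have tr: "(a, \<rho>, \<alpha>', \<nu>') \<in> transitions \<delta>" using \<tau> te by simp
      have h: "h \<tau> = (\<lambda>j. transition_coeff \<alpha> \<nu> (a, \<rho>, \<alpha>', \<nu>') j *
        state_severi (\<delta> - cost (a, \<rho>, \<alpha>', \<nu>')) \<alpha>' \<nu>' (j - 1))"
        by (rule ext) (simp only: h_def te prod.case)
      show ?thesis
      proof (cases "\<tau> = ?z")
        case True
        then have z: "a = 0" "\<rho> = 0" "\<alpha>' = 0" "\<nu>' = 0" using te by auto
        have c: "cost ?z = 0" by (simp add: excess_def)
        \<comment> \<open>The first binomial coefficient contributes 1 / |\<nu>|!, which turns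
          \<open>multinomial \<nu>\<close> into 1 / \<open>seq_fact \<nu>\<close>.\<close>
        have st: "const (multinomial \<nu>) * quantum_power \<nu> * const (1 / fact (seq_size \<nu>)) * top_coeff \<delta> = state_top \<delta> \<nu>"
        proof -
          have "1 / seq_fact \<nu> = multinomial \<nu> * (1 / fact (seq_size \<nu>))" by (simp add: multinomial_def)
          then have "const (1 / seq_fact \<nu>) = const (multinomial \<nu>) * const (1 / fact (seq_size \<nu>))"
            by (simp only: const_mult)
          then show ?thesis unfolding state_top_def by (simp only: mult_ac)
        qed
        show ?thesis
          using poly_from_transition[OF zero_transition seq_le_0, of \<delta> \<nu> \<alpha>] zero st True
          unfolding h z by (simp add: c state_top_def[of _ 0] drop1_def[of 0] add.commute del: cost.simps transition_coeff.simps)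
      next
        case False
        then have "cost (a, \<rho>, \<alpha>', \<nu>') \<noteq> 0" using cost_eq_0[OF tr] te by auto
        then have c: "cost (a, \<rho>, \<alpha>', \<nu>') > 0" by (simp only: neq0_conv)
        moreover have "cost (a, \<rho>, \<alpha>', \<nu>') \<le> \<delta>" using tr by (simp add: transitions_def)
        ultimately have "polynomial_state (\<delta> - cost (a, \<rho>, \<alpha>', \<nu>')) \<alpha>' \<nu>'"
          using tr by (intro less.IH) (auto simp: transitions_def)
        from poly_from_transition_top_0[OF tr this, of \<nu> ?D \<alpha>] show ?thesis
          unfolding h using False c by (simp del: cost.simps transition_coeff.simps)
      qed
    qed
    then have "poly_from (Suc \<delta>) ?D (\<Sum>\<tau>\<in>transitions \<delta>. if \<tau> = ?z then state_top \<delta> \<nu> else 0)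
        (\<lambda>j. \<Sum>\<tau>\<in>transitions \<delta>. h \<tau> j)"
      by (rule poly_from_sum)
    also have "(\<Sum>\<tau>\<in>transitions \<delta>. if \<tau> = ?z then state_top \<delta> \<nu> else 0) = state_top \<delta> \<nu>"
      using finite_transitions zero_transition by simp
    finally have "poly_from (\<delta> + excess \<alpha> \<nu>) ?D (state_top \<delta> \<nu>) (\<lambda>j. \<Sum>\<tau>\<in>transitions \<delta>. h \<tau> j)"
      by (rule poly_from_mono) (use False in simp)
    then show ?thesis
    proof (rule poly_from_cong)
      fix j assume "\<delta> + excess \<alpha> \<nu> \<le> j"
      then show "state_severi \<delta> \<alpha> \<nu> j = (\<Sum>\<tau>\<in>transitions \<delta>. h \<tau> j)"
        unfolding h_def using False by (intro state_severi_rec[OF less.prems]) auto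
    qed
  qed
qed

section \<open>Extreme exponents of the top coefficient\<close>

lemma qtwo_eq: "2 + qtwo ^ 2 = single 2 1 + single (- 2) 1 + single 0 4"
proof -
  have q: "qtwo = single 1 1 + single (- 1) 1"
    unfolding quantum_int_2 rat_laurent_add
    by (rule poly_mapping_eqI) (simp add: lookup_add lookup_single when_def)
  have "qtwo ^ 2 = single 2 1 + single (- 2) 1 + (1 + 1)"
    unfolding q power2_eq_square by (simp add: distrib_left distrib_right mult_single)
  moreover have "(single 0 4 :: rat half_laurent) = 4" by simp
  ultimately show ?thesis by simp
qed

lemma lookup_top_coeff_Suc:
  "lookup (top_coeff (Suc \<delta>)) n = (lookup (top_coeff \<delta>) (n - 2) + lookup (top_coeff \<delta>) (n + 2)
     + lookup (top_coeff \<delta>) n * 4) * (1 / of_nat (2 * Suc \<delta>))"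
proof -
  have "top_coeff (Suc \<delta>) = (top_coeff \<delta> * single 2 1 + top_coeff \<delta> * single (- 2) 1 + top_coeff \<delta> * single 0 4)
     * const (1 / of_nat (2 * Suc \<delta>))"
    unfolding top_coeff.simps qtwo_eq by (simp only: distrib_left mult_ac)
  then show ?thesis by (simp only: lookup_mult_single lookup_add) simp
qed

lemma lookup_top_coeff_large: "\<bar>n\<bar> > 2 * int \<delta> \<Longrightarrow> lookup (top_coeff \<delta>) n = 0"
  by (induction \<delta> arbitrary: n) (auto simp: lookup_one lookup_top_coeff_Suc simp del: top_coeff.simps(2))

text \<open>At an extreme exponent only one of the three terms of the recursion survives the
  exponent bound, so nothing can cancel.\<close>

lemma lookup_top_coeff_extreme:
  "lookup (top_coeff \<delta>) (2 * int \<delta>) > 0" "lookup (top_coeff \<delta>) (- 2 * int \<delta>) > 0"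
  by (induction \<delta>)
    (auto simp: lookup_top_coeff_Suc lookup_top_coeff_large simp del: top_coeff.simps(2))

section \<open>Passage from powers of y^(1/2) to powers of y\<close>

lemma lookup_laurent_to_half:
  "lookup (laurent_to_half p) n = (if even n then lookup p (n div 2) else 0)"
proof -
  have "lookup (laurent_to_half p) n = (\<Sum>k\<in>keys p. if 2 * k = n then lookup p k else 0)"
    by (simp add: laurent_to_half_def lookup_sum lookup_single when_def)
  also have "\<dots> = (\<Sum>k\<in>keys p. if k = n div 2 then if even n then lookup p k else 0 else 0)"
    by (rule sum.cong) auto
  also have "\<dots> = (if even n then lookup p (n div 2) else 0)"
    by (simp add: in_keys_iff)
  finally show ?thesis .
qed

text \<open>Discards odd exponents, so it inverts \<open>laurent_to_half\<close> only where all
  exponents are even.\<close>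

definition halve :: "rat half_laurent \<Rightarrow> rat laurent" where
  "halve = Poly_Mapping.map_key (\<lambda>n. 2 * n)"

lemma lookup_halve [simp]: "lookup (halve p) n = lookup p (2 * n)"
  unfolding halve_def by (subst map_key.rep_eq) (simp_all add: inj_on_def)

lemma halve_0 [simp]: "halve 0 = 0"
  by (rule poly_mapping_eqI) simp

theorem theorem1p2:
  fixes \<delta> :: nat
  assumes "\<delta> \<ge> 1"
  shows "\<exists>N :: rat laurent poly.
    degree N = 2 * \<delta> \<and> degree_y N = int \<delta> \<and> degree_y_inverse N = int \<delta> \<and>
    (\<forall>d::nat. d \<ge> \<delta> \<longrightarrow>
      laurent_to_half (poly N (of_nat d)) = Poly_Mapping.map rat_of_int (refined_severi d (int \<delta>)))"
proof -
  have "poly_from \<delta> (2 * \<delta>) (top_coeff \<delta>) (state_severi \<delta> 0 0)"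
    using polynomial_state[of 0 0 \<delta>] by (simp add: excess_def state_top_def)
  then obtain P where P: "degree P \<le> 2 * \<delta>" "coeff P (2 * \<delta>) = top_coeff \<delta>"
    "\<And>d. d \<ge> \<delta> \<Longrightarrow> state_severi \<delta> 0 0 d = poly P (of_nat d)"
    by (auto simp: poly_from_def)
  \<comment> \<open>Since \<open>d\<close> is at least \<delta> and hence positive, the convention
    of \<open>rel_severi\<close> in degree zero does not interfere.\<close>
  have val: "poly P (of_nat d) = rat_laurent (refined_severi d (int \<delta>))" if "d \<ge> \<delta>" for d
    using P(3)[OF that] that assms by (simp add: state_severi_def rel_severi_def refined_severi_def)
  have within: "exps_within (2 * int \<delta>) (poly P (of_nat d))" if "d \<ge> \<delta>" for d
    using exps_within_rat_laurent[OF exps_within_refined_rel_severi[of "single 1 d" "int \<delta>" d 0]]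
    by (simp add: val[OF that] refined_severi_def lookup_single)
  have coeffs: "exps_within (2 * int \<delta>) (coeff P i)" for i
    by (rule exps_within_coeff[OF within])
  define N where "N = map_poly halve P"
  have cN: "coeff N i = halve (coeff P i)" for i by (simp add: N_def coeff_map_poly)
  have degN: "degree N \<le> 2 * \<delta>" using P(1) by (intro degree_le) (simp add: cN coeff_eq_0)
  \<comment> \<open>Both extreme exponents already occur in the coefficient of degree 2 \<delta> in
    \<open>d\<close>.\<close>
  have ext: "int \<delta> \<in> y_exponents N" "- int \<delta> \<in> y_exponents N"
    using lookup_top_coeff_extreme[of \<delta>]
    by (auto simp: y_exponents_def in_keys_iff cN intro!: exI[of _ "2 * \<delta>"] simp: P(2))
  have bound: "n \<le> int \<delta>" "- n \<le> int \<delta>" if n: "n \<in> y_exponents N" for n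
  proof -
    obtain i where "lookup (coeff P i) (2 * n) \<noteq> 0"
      using n by (auto simp: y_exponents_def in_keys_iff cN)
    then have "\<bar>2 * n\<bar> \<le> 2 * int \<delta>" using coeffs[of i] by (simp add: exps_within_def)
    then show "n \<le> int \<delta>" "- n \<le> int \<delta>" by linarith+
  qed
  have "y_exponents N \<subseteq> {- int \<delta>..int \<delta>}"
  proof
    fix n assume "n \<in> y_exponents N"
    from bound[OF this] show "n \<in> {- int \<delta>..int \<delta>}" by simp
  qed
  then have fin: "finite (y_exponents N)" by (rule finite_subset) simp
  have "degree N = 2 * \<delta>"
  proof (rule antisym[OF degN le_degree])
    have "lookup (coeff N (2 * \<delta>)) (int \<delta>) \<noteq> 0"
      using lookup_top_coeff_extreme(1)[of \<delta>] by (simp add: cN P(2))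
    then show "coeff N (2 * \<delta>) \<noteq> 0" by auto
  qed
  moreover have "degree_y N = int \<delta>"
    unfolding degree_y_def by (rule Max_eqI[OF fin bound(1) ext(1)])
  moreover have "degree_y_inverse N = int \<delta>"
    unfolding degree_y_inverse_def
  proof (rule Max_eqI)
    show "int \<delta> \<in> uminus ` y_exponents N" using ext(2) by force
  qed (use fin bound(2) in auto)
  moreover have "laurent_to_half (poly N (of_nat d)) = Poly_Mapping.map rat_of_int (refined_severi d (int \<delta>))"
    if d: "d \<ge> \<delta>" for d
  proof (rule poly_mapping_eqI)
    fix n
    show "lookup (laurent_to_half (poly N (of_nat d))) n = lookup (rat_laurent (refined_severi d (int \<delta>))) n"
    proof (cases "even n")
      case True
      then show ?thesis unfolding val[OF d, symmetric] lookup_laurent_to_half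
        by (simp add: lookup_poly_of_nat[OF P(1)] lookup_poly_of_nat[OF degN] cN)
    next
      case False
      then show ?thesis unfolding val[OF d, symmetric] lookup_laurent_to_half
        \<comment> \<open>Odd powers of y^(1/2) are excluded by the parity in
          \<open>exps_within\<close>, as its bound 2 \<delta> is even.\<close>
        using within[OF d] by (auto simp: exps_within_def)
    qed
  qed
  ultimately show ?thesis by blast
qed

end
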